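(* Let $\sigma=(\sigma_1,\sigma_2)$ satisfy $0\le\sigma_2\le\sigma_1<1$ and $\sqrt{1-\sigma_1^2}+\sqrt{1-\sigma_2^2}>1$, and let $g(z)=1+\sigma_1z_1^2+\sigma_2z_2^2$. Let $\mathcal S_g$ be the set of positive semidefinite Hermitian $9\times9$ matrices $H$ with $\mathbf V^*H\mathbf V=|g|^2$ on $\partial\mathbb B^2$. For $H\in\mathcal S_g$ put \[ P_H=H^{1/2}\mathbf V,\qquad F_H=\frac{P_H}{g}. \] Then the following hold. (1) $F_H$ is a pointed sphere map into $\mathbb B^9$ (the displayed representation need not be reduced). (2) The assignment $H\mapsto[F_H]$, where brackets denote the stable target-unitary class, is a bijection from $\mathcal S_g$ to the set of stable target-unitary equivalence classes of pointed representations $P/g$, with $\deg P\le3$, that satisfy the sphere identity. The smallest target dimension of the class is $\operatorname{rank}H$. (3) Let $\mathcal E_H=\{v^*\mathbf V:v\in\operatorname{Range}H\}$. This is the span of the scalar components of the numerator $C\mathbf V$ for every factorization $H=C^*C$. The representation is reduced if and only if no nonconstant factor of $g$ divides every polynomial in $\mathcal E_H$. (4) Let $H_c$ be the trailing $4\times4$ principal block of $H$, indexed by the cubic monomials. The numerator has degree three if and only if $H_c\ne0$. (5) The representation $F_H$ has full rank if and only if $\operatorname{rank}H=9$, equivalently $H>0$. In that case reducedness and degree three are automatic.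
   Context: $\mathbf V=\mathbf V(z)$ is the column of length 9 with entries, in order, $z_1,z_2,\ z_1^2,\sqrt2z_1z_2,z_2^2,\ z_1^3,\sqrt3z_1^2z_2,\sqrt3z_1z_2^2,z_2^3$; these form a basis of the space $\mathcal W$ of polynomials in $z_1,z_2$ of degree at most three with zero constant term. $^*$ denotes conjugate transpose; for $H\ge0$, $H^{1/2}$ is the unique positive semidefinite Hermitian square root; $H>0$ means positive definite. $\mathbb B^n$ is the open unit ball of $\mathbb C^n$. A sphere map is a rational map $P/g$, holomorphic on $\mathbb B^2$, with $P=(p_1,\dots,p_N)^t$ a polynomial map and $g$ a scalar polynomial, satisfying the sphere identity $\|P\|^2=|g|^2$ on $\partial\mathbb B^2$. A representation $P/g$ (with $g(0)=1$) is pointed if $P(0)=0$, and reduced if $g,p_1,\dots,p_N$ have no common nonconstant polynomial factor. It has full rank if $p_1,\dots,p_N$ span $\mathcal W$. Two numerator representations $P/g$, $\widetilde P/g$ are stably target-unitarily equivalent if, after adjoining zero target components as needed, $P$ and $\widetilde P$ differ by a unitary transformation of the target. *)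

theory Defs
  imports
    "HOL-Analysis.Elementary_Normed_Spaces"
    "HOL-Computational_Algebra.Computational_Algebra"
    "Jordan_Normal_Form.Schur_Decomposition"
    "Jordan_Normal_Form.DL_Rank"
begin

text \<open>
  \<open>\<complex>[z\<^sub>1, z\<^sub>2]\<close> is represented as \<open>\<complex>[z\<^sub>1][z\<^sub>2]\<close>: the outer indeterminate is \<open>z\<^sub>2\<close>, so that
  \<open>coeff (coeff p j) i\<close> is the coefficient of \<open>z\<^sub>1\<^sup>i z\<^sub>2\<^sup>j\<close>.
  Points of \<open>\<complex>\<^sup>2\<close> are pairs, whose norm is the Euclidean one.
\<close>

type_synonym bpoly = "complex poly poly"

definition const2 :: "complex \<Rightarrow> bpoly" where
  "const2 c = [:[:c:]:]"

definition Z1 :: bpoly where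
  "Z1 = [:[:0, 1:]:]"

definition Z2 :: bpoly where
  "Z2 = [:0, 1:]"

definition eval2 :: "bpoly \<Rightarrow> complex \<times> complex \<Rightarrow> complex" where
  "eval2 p z = poly (poly p [:snd z:]) (fst z)"

lemma eval2_simps [simp]:
  "eval2 (const2 c) z = c"
  "eval2 Z1 z = fst z"
  "eval2 Z2 z = snd z"
  "eval2 0 z = 0"
  "eval2 1 z = 1"
  "eval2 (p + q) z = eval2 p z + eval2 q z"
  "eval2 (p * q) z = eval2 p z * eval2 q z"
  "eval2 (p ^ n) z = eval2 p z ^ n"
  by (simp_all add: eval2_def const2_def Z1_def Z2_def poly_power)

text \<open>The total degree, with value 0 at the zero polynomial.\<close>

definition total_degree :: "bpoly \<Rightarrow> nat" where
  "total_degree p = Max (insert 0 {i + j | i j. coeff (coeff p j) i \<noteq> 0})"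

definition vec_degree :: "bpoly vec \<Rightarrow> nat" where
  "vec_degree P = Max (insert 0 (total_degree ` set\<^sub>v P))"

definition nonconstant :: "bpoly \<Rightarrow> bool" where
  "nonconstant p \<longleftrightarrow> p \<notin> range const2"

lemma const2_hom:
  "const2 (a + b) = const2 a + const2 b"
  "const2 (a * b) = const2 a * const2 b"
  "const2 1 = 1"
  by (simp_all add: const2_def one_pCons)

global_interpretation bpoly_vs: Vector_Spaces.vector_space "\<lambda>c p. const2 c * p"
  defines cspan = bpoly_vs.span
  by unfold_locales (simp_all add: const2_hom algebra_simps)

text \<open>The space \<open>\<W>\<close>.\<close>

definition W_space :: "bpoly set" where
  "W_space = {p. total_degree p \<le> 3 \<and> eval2 p (0, 0) = 0}"

text \<open>A complex matrix acting on a column of polynomials.\<close>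

definition mat_act :: "complex mat \<Rightarrow> bpoly vec \<Rightarrow> bpoly vec" where
  "mat_act A P = map_mat const2 A *\<^sub>v P"

definition eval_vec :: "bpoly vec \<Rightarrow> complex \<times> complex \<Rightarrow> complex vec" where
  "eval_vec P z = map_vec (\<lambda>p. eval2 p z) P"

definition sq_norm2 :: "complex vec \<Rightarrow> real" where
  "sq_norm2 v = (\<Sum>i<dim_vec v. (cmod (v $ i))\<^sup>2)"

definition unit_ball :: "nat \<Rightarrow> complex vec set" where
  "unit_ball n = {v \<in> carrier_vec n. sq_norm2 v < 1}"

section \<open>Matrices\<close>

definition hermitian :: "complex mat \<Rightarrow> bool" where
  "hermitian A \<longleftrightarrow> mat_adjoint A = A"

text \<open>Note that \<open>(A *\<^sub>v x) \<bullet>c x\<close> is \<open>x\<^sup>* A x\<close>, which is real for Hermitian \<open>A\<close>.\<close>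

definition psd :: "nat \<Rightarrow> complex mat \<Rightarrow> bool" where
  "psd n A \<longleftrightarrow> A \<in> carrier_mat n n \<and> hermitian A \<and>
     (\<forall>x \<in> carrier_vec n. 0 \<le> Re ((A *\<^sub>v x) \<bullet>c x))"

definition pos_def :: "nat \<Rightarrow> complex mat \<Rightarrow> bool" where
  "pos_def n A \<longleftrightarrow> A \<in> carrier_mat n n \<and> hermitian A \<and>
     (\<forall>x \<in> carrier_vec n. x \<noteq> 0\<^sub>v n \<longrightarrow> 0 < Re ((A *\<^sub>v x) \<bullet>c x))"

definition psd_sqrt :: "nat \<Rightarrow> complex mat \<Rightarrow> complex mat" where
  "psd_sqrt n H = (THE R. psd n R \<and> R * R = H)"

definition unitary :: "nat \<Rightarrow> complex mat \<Rightarrow> bool" where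
  "unitary n U \<longleftrightarrow> U \<in> carrier_mat n n \<and> mat_adjoint U * U = 1\<^sub>m n"

definition range_mat :: "complex mat \<Rightarrow> complex vec set" where
  "range_mat A = {A *\<^sub>v x | x. x \<in> carrier_vec (dim_col A)}"

section \<open>Sphere maps and their representations\<close>

definition sphere_identity :: "bpoly vec \<Rightarrow> bpoly \<Rightarrow> bool" where
  "sphere_identity P g \<longleftrightarrow>
     (\<forall>z \<in> sphere (0, 0) 1. sq_norm2 (eval_vec P z) = (cmod (eval2 g z))\<^sup>2)"

text \<open>Holomorphy in two variables: complex-linear Frechet derivative at every point.\<close>

definition holomorphic2_on ::
    "(complex \<times> complex \<Rightarrow> complex) \<Rightarrow> (complex \<times> complex) set \<Rightarrow> bool" where
  "holomorphic2_on f S \<longleftrightarrow>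
     (\<forall>z \<in> S. \<exists>D. (f has_derivative D) (at z) \<and> (\<forall>c a b. D (c * a, c * b) = c * D (a, b)))"

text \<open>
  \<open>F\<close> is the map on the ball given by the rational map \<open>P/g\<close>. As the representation need not be
  reduced, \<open>g\<close> is not required here to be free of zeros in the ball; the values of \<open>F\<close> at such zeros
  are then those of the holomorphic extension.
\<close>

definition sphere_map :: "(complex \<times> complex \<Rightarrow> complex vec) \<Rightarrow> bpoly vec \<Rightarrow> bpoly \<Rightarrow> bool" where
  "sphere_map F P g \<longleftrightarrow>
     g \<noteq> 0 \<and>
     (\<forall>z \<in> ball (0, 0) 1. dim_vec (F z) = dim_vec P \<and> eval2 g z \<cdot>\<^sub>v F z = eval_vec P z) \<and>
     (\<forall>i < dim_vec P. holomorphic2_on (\<lambda>z. F z $ i) (ball (0, 0) 1)) \<and>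
     sphere_identity P g"

definition quotient_map :: "bpoly vec \<Rightarrow> bpoly \<Rightarrow> complex \<times> complex \<Rightarrow> complex vec" where
  "quotient_map P g z = map_vec (\<lambda>p. eval2 p z / eval2 g z) P"

definition pointed :: "bpoly vec \<Rightarrow> bpoly \<Rightarrow> bool" where
  "pointed P g \<longleftrightarrow> eval2 g (0, 0) = 1 \<and> eval_vec P (0, 0) = 0\<^sub>v (dim_vec P)"

definition reduced :: "bpoly vec \<Rightarrow> bpoly \<Rightarrow> bool" where
  "reduced P g \<longleftrightarrow> \<not> (\<exists>d. nonconstant d \<and> d dvd g \<and> (\<forall>p \<in> set\<^sub>v P. d dvd p))"

definition full_rank :: "bpoly vec \<Rightarrow> bool" where
  "full_rank P \<longleftrightarrow> cspan (set\<^sub>v P) = W_space"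

definition stably_equiv :: "bpoly vec \<Rightarrow> bpoly vec \<Rightarrow> bool" where
  "stably_equiv P Q \<longleftrightarrow>
     (\<exists>k l U. dim_vec P + k = dim_vec Q + l \<and> unitary (dim_vec P + k) U \<and>
        Q @\<^sub>v 0\<^sub>v l = mat_act U (P @\<^sub>v 0\<^sub>v k))"

text \<open>Numerators, of arbitrary target dimension, of the representations with denominator \<open>g\<close>.\<close>

definition pointed_reps :: "bpoly \<Rightarrow> bpoly vec set" where
  "pointed_reps g = {P. pointed P g \<and> vec_degree P \<le> 3 \<and> sphere_identity P g}"

definition stable_rel :: "bpoly \<Rightarrow> (bpoly vec \<times> bpoly vec) set" where
  "stable_rel g = {(P, Q). P \<in> pointed_reps g \<and> Q \<in> pointed_reps g \<and> stably_equiv P Q}"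

definition stable_class :: "bpoly \<Rightarrow> bpoly vec \<Rightarrow> bpoly vec set" where
  "stable_class g P = stable_rel g `` {P}"

section \<open>The monomial column and the Gram matrices\<close>

definition V_mono :: "bpoly vec" where
  "V_mono = vec_of_list
     [Z1, Z2,
      Z1 ^ 2, const2 (of_real (sqrt 2)) * Z1 * Z2, Z2 ^ 2,
      Z1 ^ 3, const2 (of_real (sqrt 3)) * Z1 ^ 2 * Z2, const2 (of_real (sqrt 3)) * Z1 * Z2 ^ 2, Z2 ^ 3]"

definition gram_set :: "bpoly \<Rightarrow> complex mat set" where
  "gram_set g = {H. psd 9 H \<and>
     (\<forall>z \<in> sphere (0, 0) 1.
        (H *\<^sub>v eval_vec V_mono z) \<bullet>c eval_vec V_mono z = of_real ((cmod (eval2 g z))\<^sup>2))}"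

definition P_num :: "complex mat \<Rightarrow> bpoly vec" where
  "P_num H = mat_act (psd_sqrt 9 H) V_mono"

definition F_map :: "complex mat \<Rightarrow> bpoly \<Rightarrow> complex \<times> complex \<Rightarrow> complex vec" where
  "F_map H g = quotient_map (P_num H) g"

text \<open>The polynomials \<open>v\<^sup>* V\<close>.\<close>

definition E_space :: "complex mat \<Rightarrow> bpoly set" where
  "E_space H = {scalar_prod (map_vec const2 (conjugate v)) V_mono | v. v \<in> range_mat H}"

definition cubic_block :: "complex mat \<Rightarrow> complex mat" where
  "cubic_block H = mat 4 4 (\<lambda>(i, j). H $$ (i + 5, j + 5))"

definition g_poly :: "real \<Rightarrow> real \<Rightarrow> bpoly" where
  "g_poly \<sigma>1 \<sigma>2 = 1 + const2 (of_real \<sigma>1) * Z1 ^ 2 + const2 (of_real \<sigma>2) * Z2 ^ 2"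

end

theory Submission
  imports "HOL-Complex_Analysis.Conformal_Mappings" Defs
begin

text \<open>
  The nine entries of \<open>V\<close> form a basis of the polynomials of degree at most three without constant
  term. Hence a pointed numerator of degree at most three is \<open>C V\<close> for exactly one matrix \<open>C\<close>
  (\<open>pointed_reps_factor\<close>, \<open>mat_act_V_inj\<close>), and \<open>\<parallel>C V\<parallel>\<^sup>2 = V\<^sup>* (C\<^sup>* C) V\<close> turns the sphere
  identity into the condition that the Gram matrix \<open>C\<^sup>* C\<close> lies in \<open>\<S>\<^sub>g\<close>. Everything in the theorem
  is a statement about factorizations \<open>H = C\<^sup>* C\<close>, of which \<open>C = H\<^sup>1\<^sup>/\<^sup>2\<close> is one.

  Two matrices have the same Gram matrix if and only if, after padding with zero rows, they differ by
  a unitary factor on the left (\<open>unitary_freedom\<close>). By uniqueness of \<open>C\<close> this says that the stable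
  target-unitary class of \<open>C V\<close> is the set of all \<open>B V\<close> with \<open>B\<^sup>* B = C\<^sup>* C\<close>, which is the bijection.
  The number of rows of such a \<open>B\<close> is at least the rank of \<open>H\<close>, and the spectral theorem
  gives a factor with exactly that many rows (\<open>psd_minimal_factorization\<close>).

  The range of \<open>C\<^sup>* C\<close> equals that of \<open>C\<^sup>*\<close> (\<open>range_gram\<close>), and \<open>(C\<^sup>* x)\<^sup>* V = x\<^sup>* (C V)\<close>. So
  \<open>\<E>\<^sub>H\<close> is the span of the components of \<open>C V\<close>; this describes reducedness, and it describes full
  rank because \<open>\<E>\<^sub>H\<close> is everything exactly if \<open>H\<close> is onto. In that case \<open>z\<^sub>1\<close> and \<open>z\<^sub>2\<close> are in the
  span, and they have no common factor. The cubic part of the numerator is seen by the last four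
  columns of \<open>H\<^sup>1\<^sup>/\<^sup>2\<close>, whose Gram matrix is the cubic block of \<open>H\<close>.

  Since \<open>g\<close> has no zero in the closed ball, \<open>F\<^sub>H\<close> is holomorphic near it. It maps the sphere to the
  sphere and the origin to the origin, so that the Schwarz lemma on complex lines through the origin
  puts the image of the ball into the ball.
\<close>

text \<open>From here on, \<open>$\<close> and \<open>\<bullet>\<close> only denote entries and scalar products of the vectors of variable length.\<close>

unbundle no vec_syntax and no inner_syntax
no_notation fps_nth (infixl "$" 75)

section \<open>Adjoints\<close>

lemma mat_adjoint_dim [simp]:
  "dim_row (mat_adjoint A) = dim_col A" "dim_col (mat_adjoint A) = dim_row A"
  by (simp_all add: mat_adjoint_def)

lemma mat_adjoint_carrier [simp]:
  "A \<in> carrier_mat m n \<Longrightarrow> mat_adjoint A \<in> carrier_mat n m"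
  by (rule carrier_matI) simp_all

lemma mat_adjoint_index [simp]:
  fixes A :: "complex mat"
  shows "i < dim_col A \<Longrightarrow> j < dim_row A \<Longrightarrow> mat_adjoint A $$ (i, j) = cnj (A $$ (j, i))"
  by (simp add: mat_adjoint_def mat_of_rows_def conjugate_vec_def)

lemma mat_adjoint_adjoint [simp]: "mat_adjoint (mat_adjoint A) = (A :: complex mat)"
  by (rule eq_matI) auto

lemma mat_adjoint_one [simp]: "mat_adjoint (1\<^sub>m n :: complex mat) = 1\<^sub>m n"
  by (rule eq_matI) auto

lemma mat_adjoint_mult:
  fixes A B :: "complex mat"
  assumes "A \<in> carrier_mat m n" "B \<in> carrier_mat n k"
  shows "mat_adjoint (A * B) = mat_adjoint B * mat_adjoint A"
  using assms by (intro eq_matI) (auto simp: scalar_prod_def intro!: sum.cong)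

lemma cscalar_prod_sum:
  fixes x y :: "complex vec"
  shows "x \<in> carrier_vec n \<Longrightarrow> y \<in> carrier_vec n \<Longrightarrow> x \<bullet>c y = (\<Sum>i<n. x $ i * cnj (y $ i))"
  by (simp add: scalar_prod_def lessThan_atLeast0)

lemma mult_mat_vec_sum:
  "A \<in> carrier_mat m n \<Longrightarrow> x \<in> carrier_vec n \<Longrightarrow> i < m \<Longrightarrow> (A *\<^sub>v x) $ i = (\<Sum>j<n. A $$ (i, j) * x $ j)"
  by (auto simp: scalar_prod_def lessThan_atLeast0 intro!: sum.cong)

lemma mult_mat_sum:
  "A \<in> carrier_mat m n \<Longrightarrow> B \<in> carrier_mat n k \<Longrightarrow> i < m \<Longrightarrow> j < k \<Longrightarrow>
    (A * B) $$ (i, j) = (\<Sum>l<n. A $$ (i, l) * B $$ (l, j))"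
  by (auto simp: scalar_prod_def lessThan_atLeast0 intro!: sum.cong)

lemma cscalar_prod_self:
  fixes x :: "complex vec"
  shows "x \<bullet>c x = of_real (sq_norm2 x)"
  by (simp add: cscalar_prod_sum[of x "dim_vec x"] sq_norm2_def complex_norm_square
      flip: of_real_power)

lemma sq_norm2_eq_0_iff: "x \<in> carrier_vec n \<Longrightarrow> sq_norm2 x = 0 \<longleftrightarrow> x = 0\<^sub>v n"
  by (auto simp: sq_norm2_def sum_nonneg_eq_0_iff)

lemma adjoint_inner:
  fixes A :: "complex mat"
  assumes A: "A \<in> carrier_mat m n" and x: "x \<in> carrier_vec n" and y: "y \<in> carrier_vec m"
  shows "(A *\<^sub>v x) \<bullet>c y = x \<bullet>c (mat_adjoint A *\<^sub>v y)"
proof -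
  have "(A *\<^sub>v x) \<bullet>c y = (\<Sum>i<m. \<Sum>j<n. A $$ (i, j) * x $ j * cnj (y $ i))"
    using assms by (subst cscalar_prod_sum[of _ m])
      (auto simp del: index_mult_mat_vec simp: mult_mat_vec_sum[OF A x] sum_distrib_right)
  also have "\<dots> = (\<Sum>j<n. \<Sum>i<m. A $$ (i, j) * x $ j * cnj (y $ i))"
    by (rule sum.swap)
  also have "\<dots> = x \<bullet>c (mat_adjoint A *\<^sub>v y)"
    using assms by (subst cscalar_prod_sum[of _ n])
      (auto simp del: index_mult_mat_vec simp: mult_mat_vec_sum[OF mat_adjoint_carrier[OF A] y]
        sum_distrib_left algebra_simps intro!: sum.cong mult_mat_vec_carrier mat_adjoint_carrier)
  finally show ?thesis .
qed

lemma gram_inner: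
  fixes C :: "complex mat"
  assumes C: "C \<in> carrier_mat m n" and x: "x \<in> carrier_vec n" and y: "y \<in> carrier_vec n"
  shows "((mat_adjoint C * C) *\<^sub>v x) \<bullet>c y = (C *\<^sub>v x) \<bullet>c (C *\<^sub>v y)"
proof -
  have "(mat_adjoint C * C) *\<^sub>v x = mat_adjoint C *\<^sub>v (C *\<^sub>v x)"
    using assoc_mult_mat_vec[OF mat_adjoint_carrier[OF C] C x] .
  also have "\<dots> \<bullet>c y = (C *\<^sub>v x) \<bullet>c (mat_adjoint (mat_adjoint C) *\<^sub>v y)"
    by (rule adjoint_inner[OF mat_adjoint_carrier[OF C] mult_mat_vec_carrier[OF C x] y])
  finally show ?thesis by simp
qed

lemma gram_index:
  fixes A :: "complex mat"
  assumes "A \<in> carrier_mat m n" "i < n" "j < n"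
  shows "(mat_adjoint A * A) $$ (i, j) = col A j \<bullet>c col A i"
  using assms by (auto simp: scalar_prod_def intro!: sum.cong)

lemma gram_eq_0_imp_eq_0:
  fixes A :: "complex mat"
  assumes A: "A \<in> carrier_mat m n" and 0: "mat_adjoint A * A = 0\<^sub>m n n"
  shows "A = 0\<^sub>m m n"
proof (rule eq_matI)
  fix i j assume ij: "i < dim_row (0\<^sub>m m n :: complex mat)" "j < dim_col (0\<^sub>m m n :: complex mat)"
  have "col A j \<bullet>c col A j = 0" using gram_index[OF A, of j j] ij 0 by simp
  then have "col A j = 0\<^sub>v m"
    using A ij by (simp add: cscalar_prod_self sq_norm2_eq_0_iff[of _ m] col_carrier_vec)
  then have "col A j $ i = 0" using ij by simp
  then show "A $$ (i, j) = 0\<^sub>m m n $$ (i, j)" using A ij by simp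
qed (use A in auto)

lemma gram_psd:
  assumes C: "C \<in> carrier_mat m n"
  shows "psd n (mat_adjoint C * C)"
proof -
  have "0 \<le> Re (((mat_adjoint C * C) *\<^sub>v x) \<bullet>c x)" if "x \<in> carrier_vec n" for x
    using gram_inner[OF C that that] by (simp add: cscalar_prod_self sq_norm2_def sum_nonneg)
  then show ?thesis
    using C mat_adjoint_mult[OF mat_adjoint_carrier[OF C] C] by (auto simp: psd_def hermitian_def)
qed

section \<open>Unitary freedom\<close>

lemma unitary_one: "unitary n (1\<^sub>m n)"
  by (simp add: unitary_def)

lemma unitary_carrier: "unitary n U \<Longrightarrow> U \<in> carrier_mat n n"
  by (simp add: unitary_def)

lemma unitary_right: "unitary n U \<Longrightarrow> U * mat_adjoint U = 1\<^sub>m n"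
  by (auto simp: unitary_def intro: mat_mult_left_right_inverse[of _ n])

lemma unitary_gram:
  assumes U: "unitary n U" and A: "A \<in> carrier_mat n k"
  shows "mat_adjoint (U * A) * (U * A) = mat_adjoint A * A"
proof -
  have U': "U \<in> carrier_mat n n" and UU: "mat_adjoint U * U = 1\<^sub>m n" using U by (auto simp: unitary_def)
  have "mat_adjoint (U * A) * (U * A) = mat_adjoint A * (mat_adjoint U * (U * A))"
    unfolding mat_adjoint_mult[OF \<open>U \<in> carrier_mat n n\<close> A]
    by (rule assoc_mult_mat[OF mat_adjoint_carrier[OF A] mat_adjoint_carrier mult_carrier_mat[OF _ A]])
      fact+
  also have "mat_adjoint U * (U * A) = A"
    using A UU by (simp flip: assoc_mult_mat[OF mat_adjoint_carrier[OF U'] U' A])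
  finally show ?thesis .
qed

lemma unitary_mult: "unitary n U \<Longrightarrow> unitary n W \<Longrightarrow> unitary n (U * W)"
  using unitary_gram[of n U W n] by (auto simp: unitary_def)

lemma unitary_inner:
  assumes U: "unitary n U" and "x \<in> carrier_vec n" "y \<in> carrier_vec n"
  shows "(U *\<^sub>v x) \<bullet>c (U *\<^sub>v y) = x \<bullet>c y"
  using gram_inner[of U n n x y] assms by (simp add: unitary_def)

text \<open>
  Put \<open>w = a - b\<close>. The map \<open>1 - t w w\<^sup>*\<close> fixes every vector orthogonal to \<open>w\<close>, and it sends \<open>a\<close>
  to \<open>b\<close> if \<open>t = 1 / (w\<^sup>* a)\<close>. It is unitary if \<open>2 Re (1 / t) = \<parallel>w\<parallel>\<^sup>2\<close>, and this is what equality
  of the norms of \<open>a\<close> and \<open>b\<close> amounts to. Unlike for a real reflection, \<open>t\<close> need not be real.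
\<close>

lemma householder:
  fixes a b :: "complex vec"
  assumes a: "a \<in> carrier_vec n" and b: "b \<in> carrier_vec n" and ab: "sq_norm2 a = sq_norm2 b"
  shows "\<exists>U. unitary n U \<and> U *\<^sub>v a = b \<and>
    (\<forall>x \<in> carrier_vec n. x \<bullet>c a = x \<bullet>c b \<longrightarrow> U *\<^sub>v x = x)"
proof (cases "a = b")
  case True
  then show ?thesis using a by (intro exI[of _ "1\<^sub>m n"]) (auto simp: unitary_one)
next
  case False
  define w where "w = (\<lambda>i. a $ i - b $ i)"
  define s where "s = (\<Sum>i<n. a $ i * cnj (w i))"
  define t where "t = 1 / s"
  define U where "U = mat n n (\<lambda>(i, j). (if i = j then 1 else 0) - t * w i * cnj (w j))"
  have U[simp]: "U \<in> carrier_mat n n" by (simp add: U_def)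
  have eq: "(\<Sum>i<n. a $ i * cnj (a $ i)) = (\<Sum>i<n. b $ i * cnj (b $ i))"
    using ab cscalar_prod_self[of a] cscalar_prod_self[of b] cscalar_prod_sum[OF a a] cscalar_prod_sum[OF b b]
    by simp
  \<comment> \<open>Equality of the norms, in the form needed for unitarity.\<close>
  have ww: "(\<Sum>i<n. w i * cnj (w i)) = s + cnj s"
    using eq by (simp add: s_def w_def algebra_simps sum.distrib sum_subtractf)
  have "s \<noteq> 0"
  proof
    assume "s = 0"
    then have "complex_of_real (\<Sum>i<n. (cmod (w i))\<^sup>2) = of_real 0"
      using ww unfolding of_real_sum complex_norm_square by simp
    then have "(\<Sum>i<n. (cmod (w i))\<^sup>2) = 0" unfolding of_real_eq_iff .
    then have "\<forall>i<n. w i = 0" by (simp add: sum_nonneg_eq_0_iff)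
    then have "a = b" using a b by (intro eq_vecI) (auto simp: w_def)
    then show False using False by simp
  qed
  have act: "U *\<^sub>v x = vec n (\<lambda>i. x $ i - t * w i * (\<Sum>j<n. x $ j * cnj (w j)))"
    if x: "x \<in> carrier_vec n" for x
  proof (rule eq_vecI)
    fix i assume i: "i < dim_vec (vec n (\<lambda>i. x $ i - t * w i * (\<Sum>j<n. x $ j * cnj (w j))))"
    have "(U *\<^sub>v x) $ i = (\<Sum>j<n. ((if i = j then 1 else 0) - t * w i * cnj (w j)) * x $ j)"
      using i by (subst mult_mat_vec_sum[OF U x]) (auto simp: U_def)
    also have "\<dots> = (\<Sum>j<n. (if i = j then x $ j else 0) - t * w i * (x $ j * cnj (w j)))"
      by (intro sum.cong) (auto simp: algebra_simps)
    also have "\<dots> = (\<Sum>j<n. (if i = j then x $ j else 0)) - t * w i * (\<Sum>j<n. x $ j * cnj (w j))"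
      by (simp only: sum_subtractf sum_distrib_left)
    finally show "(U *\<^sub>v x) $ i = vec n (\<lambda>i. x $ i - t * w i * (\<Sum>j<n. x $ j * cnj (w j))) $ i"
      using i by simp
  qed (simp add: U_def)
  \<comment> \<open>The sum of the terms of \<open>U\<^sup>* U\<close> that involve \<open>w\<close> vanishes.\<close>
  have tt: "cnj t * t * (s + cnj s) = t + cnj t"
    using \<open>s \<noteq> 0\<close> by (simp add: t_def field_simps)
  have "mat_adjoint U * U = 1\<^sub>m n"
  proof (rule eq_matI)
    fix i j assume "i < dim_row (1\<^sub>m n :: complex mat)" "j < dim_col (1\<^sub>m n :: complex mat)"
    then have ij: "i < n" "j < n" by auto
    have "(mat_adjoint U * U) $$ (i, j) =
        (\<Sum>k<n. cnj ((if k = i then 1 else 0) - t * w k * cnj (w i)) * ((if k = j then 1 else 0) - t * w k * cnj (w j)))"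
      using ij by (subst mult_mat_sum[OF mat_adjoint_carrier[OF U] U]) (auto simp: U_def intro!: sum.cong)
    also have "\<dots> = (\<Sum>k<n. (if k = i then if i = j then 1 else 0 else 0)
          - (if k = i then t * w i * cnj (w j) else 0) - (if k = j then cnj t * w i * cnj (w j) else 0)
          + cnj t * t * w i * cnj (w j) * (w k * cnj (w k)))"
      by (intro sum.cong) (auto simp: algebra_simps)
    also have "\<dots> = (if i = j then 1 else 0) - t * w i * cnj (w j) - cnj t * w i * cnj (w j)
          + cnj t * t * w i * cnj (w j) * (s + cnj s)"
      using ij by (simp add: sum.distrib sum_subtractf ww flip: sum_distrib_left)
    also have "\<dots> = (if i = j then 1 else 0) + (cnj t * t * (s + cnj s) - (t + cnj t)) * w i * cnj (w j)"
      by (simp add: algebra_simps)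
    finally show "(mat_adjoint U * U) $$ (i, j) = 1\<^sub>m n $$ (i, j)"
      using ij by (simp add: tt)
  qed (auto simp: U_def)
  then have "unitary n U" by (simp add: unitary_def)
  moreover have "U *\<^sub>v a = b"
    unfolding act[OF a] s_def[symmetric] using \<open>s \<noteq> 0\<close> b by (intro eq_vecI) (auto simp: t_def w_def)
  moreover have "U *\<^sub>v x = x" if x: "x \<in> carrier_vec n" and "x \<bullet>c a = x \<bullet>c b" for x
  proof -
    have "(\<Sum>j<n. x $ j * cnj (w j)) = 0"
      using that(2) unfolding cscalar_prod_sum[OF x a] cscalar_prod_sum[OF x b]
      by (simp add: w_def algebra_simps sum_subtractf)
    then show ?thesis unfolding act[OF x] using x by (intro eq_vecI) auto
  qed
  ultimately show ?thesis by blast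
qed

text \<open>
  The columns are matched one after the other: equality of the Gram matrices makes the columns that
  are already matched orthogonal to the vector \<open>w\<close> of the next Householder map, which therefore
  fixes them.
\<close>

lemma unitary_freedom:
  fixes A B :: "complex mat"
  assumes A: "A \<in> carrier_mat n k" and B: "B \<in> carrier_mat n k"
    and eq: "mat_adjoint A * A = mat_adjoint B * B"
  shows "\<exists>U. unitary n U \<and> U * A = B"
proof -
  have inner: "col A i \<bullet>c col A j = col B i \<bullet>c col B j" if "i < k" "j < k" for i j
    using gram_index[OF A that(2,1)] gram_index[OF B that(2,1)] eq by simp
  have cA[simp]: "col A i \<in> carrier_vec n" and cB[simp]: "col B i \<in> carrier_vec n" for i
    using A B by (auto simp: carrier_vecI)
  have "\<exists>U. unitary n U \<and> (\<forall>i<l. U *\<^sub>v col A i = col B i)" if "l \<le> k" for l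
    using that
  proof (induction l)
    case 0
    then show ?case using unitary_one by auto
  next
    case (Suc l)
    then obtain U where U: "unitary n U" and UA: "\<And>i. i < l \<Longrightarrow> U *\<^sub>v col A i = col B i" by auto
    note [simp] = unitary_carrier[OF U]
    define a where "a = U *\<^sub>v col A l"
    have a: "a \<in> carrier_vec n" unfolding a_def by (rule mult_mat_vec_carrier[OF unitary_carrier[OF U] cA])
    have "a \<bullet>c a = col B l \<bullet>c col B l"
      using Suc.prems by (simp add: a_def unitary_inner[OF U] inner)
    then have norm: "sq_norm2 a = sq_norm2 (col B l)" unfolding cscalar_prod_self of_real_eq_iff .
    obtain W where W: "unitary n W" "W *\<^sub>v a = col B l"
      and fix_W: "\<And>x. x \<in> carrier_vec n \<Longrightarrow> x \<bullet>c a = x \<bullet>c col B l \<Longrightarrow> W *\<^sub>v x = x"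
      using householder[OF a cB norm] by blast
    have orth: "col B i \<bullet>c a = col B i \<bullet>c col B l" if "i < l" for i
    proof -
      have "col B i \<bullet>c a = (U *\<^sub>v col A i) \<bullet>c (U *\<^sub>v col A l)" using UA[OF that] by (simp add: a_def)
      also have "\<dots> = col B i \<bullet>c col B l"
        using Suc.prems that by (subst unitary_inner[OF U]) (auto intro!: inner)
      finally show ?thesis .
    qed
    have "(W * U) *\<^sub>v col A i = col B i" if "i < Suc l" for i
    proof -
      have "(W * U) *\<^sub>v col A i = W *\<^sub>v (U *\<^sub>v col A i)"
        using unitary_carrier[OF W(1)] by (intro assoc_mult_mat_vec[of _ n n _ n]) auto
      then show ?thesis
        using that UA[of i] fix_W[OF cB orth, of i] W(2) by (cases "i = l") (auto simp: a_def)
    qed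
    then show ?case using unitary_mult[OF W(1) U] by blast
  qed
  from this[of k] obtain U where U: "unitary n U" and UA: "\<And>i. i < k \<Longrightarrow> U *\<^sub>v col A i = col B i" by auto
  have "U * A = B"
  proof (rule mat_col_eqI)
    fix i assume "i < dim_col B"
    then show "col (U * A) i = col B i"
      using A B unitary_carrier[OF U] UA[of i] by (simp add: col_mult2[of _ n n _ k])
  qed (use A B unitary_carrier[OF U] in auto)
  then show ?thesis using U by blast
qed

section \<open>The spectral theorem\<close>

definition real_diag :: "nat \<Rightarrow> (nat \<Rightarrow> real) \<Rightarrow> complex mat" where
  "real_diag n d = mat n n (\<lambda>(i, j). if i = j then of_real (d i) else 0)"

lemma real_diag_carrier [simp]: "real_diag n d \<in> carrier_mat n n"
  by (simp add: real_diag_def)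

lemma real_diag_dim [simp]: "dim_row (real_diag n d) = n" "dim_col (real_diag n d) = n"
  by (simp_all add: real_diag_def)

lemma mult_real_diag_index:
  assumes "U \<in> carrier_mat m n" "i < m" "j < n"
  shows "(U * real_diag n d) $$ (i, j) = U $$ (i, j) * of_real (d j)"
proof -
  have "(U * real_diag n d) $$ (i, j) = (\<Sum>l<n. if l = j then U $$ (i, l) * of_real (d l) else 0)"
    unfolding mult_mat_sum[OF assms(1) real_diag_carrier assms(2,3)]
    using assms by (intro sum.cong) (auto simp: real_diag_def)
  then show ?thesis using assms by simp
qed

lemma complex_eigenvector_exists:
  fixes A :: "complex mat"
  assumes A: "A \<in> carrier_mat (Suc n) (Suc n)"
  shows "\<exists>v \<mu>. v \<in> carrier_vec (Suc n) \<and> v \<noteq> 0\<^sub>v (Suc n) \<and> A *\<^sub>v v = \<mu> \<cdot>\<^sub>v v"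
proof -
  have "degree (char_poly A) > 0" using degree_monic_char_poly[OF A] by simp
  then have "\<not> constant (poly (char_poly A))" by (simp add: constant_degree)
  then obtain \<mu> where "poly (char_poly A) \<mu> = 0" using fundamental_theorem_of_algebra by blast
  then have "eigenvalue A \<mu>" using eigenvalue_root_char_poly[OF A] by simp
  then show ?thesis using A unfolding eigenvalue_def eigenvector_def by auto
qed

lemma assoc_square:
  "A \<in> carrier_mat n n \<Longrightarrow> B \<in> carrier_mat n n \<Longrightarrow> C \<in> carrier_mat n n \<Longrightarrow> A * B * C = A * (B * C)"
  by (rule assoc_mult_mat)

text \<open>
  A Householder map moves the first coordinate vector into the direction of an eigenvector. In the new
  coordinates, the first column of the matrix is a multiple of the first coordinate vector, and so is
  the first row because the matrix stays Hermitian.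
\<close>

lemma hermitian_deflation:
  assumes A: "A \<in> carrier_mat (Suc n) (Suc n)" and herm: "hermitian A"
  shows "\<exists>W r B. unitary (Suc n) W \<and> B \<in> carrier_mat n n \<and> hermitian B \<and>
    A * W = W * four_block_mat (real_diag 1 (\<lambda>_. r)) (0\<^sub>m 1 n) (0\<^sub>m n 1) B"
proof -
  obtain v \<mu> where v: "v \<in> carrier_vec (Suc n)" "v \<noteq> 0\<^sub>v (Suc n)" and eig: "A *\<^sub>v v = \<mu> \<cdot>\<^sub>v v"
    using complex_eigenvector_exists[OF A] by blast
  define e where "e = (unit_vec (Suc n) 0 :: complex vec)"
  \<comment> \<open>A Householder map preserves norms, so the coordinate vector is first scaled to the length of \<open>v\<close>.\<close>
  define c where "c = complex_of_real (sqrt (sq_norm2 v))"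
  have e: "e \<in> carrier_vec (Suc n)" by (simp add: e_def)
  have pos: "0 < sq_norm2 v"
    using v sq_norm2_eq_0_iff[OF v(1)] by (simp add: sq_norm2_def sum_nonneg less_le)
  have c0: "c \<noteq> 0" using pos by (simp add: c_def)
  have "sq_norm2 (c \<cdot>\<^sub>v e) = (\<Sum>i<Suc n. if i = 0 then sq_norm2 v else 0)"
    unfolding sq_norm2_def[of "c \<cdot>\<^sub>v e"] using pos
    by (intro sum.cong) (auto simp: e_def c_def norm_mult unit_vec_def)
  then have norm: "sq_norm2 (c \<cdot>\<^sub>v e) = sq_norm2 v" by simp
  obtain W where W: "unitary (Suc n) W" and We: "W *\<^sub>v (c \<cdot>\<^sub>v e) = v"
    using householder[OF smult_carrier_vec[THEN iffD2, OF e] v(1) norm] by blast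
  note W' = unitary_carrier[OF W]
  note aW' = mat_adjoint_carrier[OF W']
  have We': "v = c \<cdot>\<^sub>v (W *\<^sub>v e)" using We mult_mat_vec[OF W' e] by simp
  define M where "M = mat_adjoint W * (A * W)"
  have M: "M \<in> carrier_mat (Suc n) (Suc n)" using W' A aW' by (auto simp: M_def)
  have WM: "A * W = W * M"
    unfolding M_def using A W' aW' unitary_right[OF W]
    by (simp flip: assoc_square[of W "Suc n" "mat_adjoint W" "A * W"])
  have "A *\<^sub>v (W *\<^sub>v e) = \<mu> \<cdot>\<^sub>v (W *\<^sub>v e)"
  proof -
    have "c \<cdot>\<^sub>v (A *\<^sub>v (W *\<^sub>v e)) = A *\<^sub>v v"
      unfolding We' using mult_mat_vec[OF A mult_mat_vec_carrier[OF W' e]] by simp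
    also have "\<dots> = c \<cdot>\<^sub>v (\<mu> \<cdot>\<^sub>v (W *\<^sub>v e))"
      unfolding eig unfolding We' by (simp add: smult_smult_assoc mult.commute)
    finally have "(1 / c) \<cdot>\<^sub>v (c \<cdot>\<^sub>v (A *\<^sub>v (W *\<^sub>v e))) = (1 / c) \<cdot>\<^sub>v (c \<cdot>\<^sub>v (\<mu> \<cdot>\<^sub>v (W *\<^sub>v e)))" by simp
    then show ?thesis using c0 by (simp add: smult_smult_assoc)
  qed
  then have "M *\<^sub>v e = mat_adjoint W *\<^sub>v (\<mu> \<cdot>\<^sub>v (W *\<^sub>v e))"
    unfolding M_def using assoc_mult_mat_vec[OF aW' mult_carrier_mat[OF A W'] e] assoc_mult_mat_vec[OF A W' e]
    by simp
  also have "\<dots> = \<mu> \<cdot>\<^sub>v ((mat_adjoint W * W) *\<^sub>v e)"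
    using mult_mat_vec[OF aW' mult_mat_vec_carrier[OF W' e]] assoc_mult_mat_vec[OF aW' W' e] by simp
  finally have Me: "M *\<^sub>v e = \<mu> \<cdot>\<^sub>v e" using W e by (simp add: unitary_def)
  have col: "M $$ (i, 0) = (if i = 0 then \<mu> else 0)" if i: "i < Suc n" for i
  proof -
    have "(M *\<^sub>v e) $ i = (\<Sum>j<Suc n. if j = 0 then M $$ (i, 0) else 0)"
      unfolding mult_mat_vec_sum[OF M e i] by (intro sum.cong) (auto simp: e_def unit_vec_def)
    then show ?thesis using Me i by (simp add: e_def unit_vec_def split: if_splits)
  qed
  have Mh: "mat_adjoint M = M"
  proof -
    have "mat_adjoint M = mat_adjoint (A * W) * W"
      unfolding M_def using mat_adjoint_mult[OF aW' mult_carrier_mat[OF A W']] by simp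
    also have "\<dots> = mat_adjoint W * A * W"
      using mat_adjoint_mult[OF A W'] herm by (simp add: hermitian_def)
    finally show ?thesis unfolding M_def using assoc_square[OF aW' A W'] by simp
  qed
  have herm_entry: "M $$ (i, j) = cnj (M $$ (j, i))" if "i < Suc n" "j < Suc n" for i j
    using arg_cong[OF Mh, of "\<lambda>X. X $$ (i, j)"] M that by simp
  have row: "M $$ (0, j) = (if j = 0 then \<mu> else 0)" if j: "j < Suc n" for j
    using herm_entry[of 0 j] col[of j] col[of 0] herm_entry[of 0 0] j by (auto split: if_splits)
  have \<mu>: "\<mu> = of_real (Re \<mu>)"
    using herm_entry[of 0 0] col[of 0] by (simp add: complex_eq_iff)
  define B where "B = mat n n (\<lambda>(i, j). M $$ (Suc i, Suc j))"
  have "hermitian B"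
    unfolding hermitian_def by (rule eq_matI) (auto simp: B_def intro!: herm_entry[symmetric])
  moreover have "M = four_block_mat (real_diag 1 (\<lambda>_. Re \<mu>)) (0\<^sub>m 1 n) (0\<^sub>m n 1) B"
    using M by (intro eq_matI) (auto simp: B_def real_diag_def row col \<mu>[symmetric])
  moreover have "B \<in> carrier_mat n n" by (simp add: B_def)
  ultimately show ?thesis using W WM by blast
qed

text \<open>
  Deflation splits off one eigenvalue at a time; the unitary matrix of the smaller block is extended by 1.
\<close>

lemma hermitian_spectral:
  assumes "A \<in> carrier_mat n n" "hermitian A"
  shows "\<exists>U d. unitary n U \<and> A * U = U * real_diag n d"
  using assms
proof (induction n arbitrary: A)
  case 0
  then show ?case
    by (intro exI[of _ "1\<^sub>m 0"] exI) (auto simp: unitary_one intro!: eq_matI)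
next
  case (Suc n)
  obtain W r B where W: "unitary (Suc n) W" and B: "B \<in> carrier_mat n n" "hermitian B"
    and AW: "A * W = W * four_block_mat (real_diag 1 (\<lambda>_. r)) (0\<^sub>m 1 n) (0\<^sub>m n 1) B"
    using hermitian_deflation[OF Suc.prems] by blast
  obtain U d where U: "unitary n U" and BU: "B * U = U * real_diag n d" using Suc.IH[OF B] by blast
  note U' = unitary_carrier[OF U] and W' = unitary_carrier[OF W]
  define M where "M = four_block_mat (real_diag 1 (\<lambda>_. r)) (0\<^sub>m 1 n) (0\<^sub>m n 1) B"
  define X where "X = four_block_mat (1\<^sub>m 1) (0\<^sub>m 1 n) (0\<^sub>m n 1) U"
  define D where "D = real_diag (Suc n) (case_nat r d)"
  have D: "D = four_block_mat (real_diag 1 (\<lambda>_. r)) (0\<^sub>m 1 n) (0\<^sub>m n 1) (real_diag n d)"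
    by (rule eq_matI) (auto simp: D_def real_diag_def split: nat.split)
  have X': "X \<in> carrier_mat (Suc n) (Suc n)" and M': "M \<in> carrier_mat (Suc n) (Suc n)"
    and D': "D \<in> carrier_mat (Suc n) (Suc n)"
    unfolding X_def M_def D_def
    using four_block_carrier_mat[OF one_carrier_mat U', of 1] four_block_carrier_mat[OF real_diag_carrier B(1), of 1]
    by simp_all
  have aX: "mat_adjoint X = four_block_mat (1\<^sub>m 1) (0\<^sub>m 1 n) (0\<^sub>m n 1) (mat_adjoint U)"
    using U' by (intro eq_matI) (auto simp: X_def)
  have "mat_adjoint X * X = four_block_mat (1\<^sub>m 1) (0\<^sub>m 1 n) (0\<^sub>m n 1) (mat_adjoint U * U)"
    unfolding aX unfolding X_def using U'
    by (subst mult_four_block_mat[of _ 1 1 _ n _ n _ _ 1 _ n]) auto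
  then have X: "unitary (Suc n) X"
    using X' U by (simp add: unitary_def)
  have "M * X = four_block_mat (real_diag 1 (\<lambda>_. r)) (0\<^sub>m 1 n) (0\<^sub>m n 1) (B * U)"
    unfolding M_def X_def using U' B
    by (subst mult_four_block_mat[of _ 1 1 _ n _ n _ _ 1 _ n])
      (simp_all del: One_nat_def add: right_mult_one_mat[OF real_diag_carrier] right_mult_zero_mat[OF real_diag_carrier]
        left_add_zero_mat right_add_zero_mat[OF real_diag_carrier])
  also have "\<dots> = X * D"
    unfolding D X_def BU using U'
    by (subst mult_four_block_mat[of _ 1 1 _ n _ n _ _ 1 _ n])
      (simp_all del: One_nat_def add: left_mult_one_mat[OF real_diag_carrier] left_mult_zero_mat[OF real_diag_carrier]
        right_add_zero_mat[OF real_diag_carrier])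
  finally have MX: "M * X = X * D" .
  have "A * (W * X) = (A * W) * X" using assoc_square[OF Suc.prems(1) W' X'] by simp
  also have "\<dots> = W * (M * X)" unfolding AW M_def[symmetric] by (rule assoc_square[OF W' M' X'])
  also have "\<dots> = (W * X) * D" unfolding MX using assoc_square[OF W' X' D'] by simp
  finally show ?case using unitary_mult[OF W X] unfolding D_def by blast
qed

section \<open>Positive semidefinite matrices\<close>

text \<open>
  If \<open>H\<close> is diagonalized by \<open>U\<close> with eigenvalues \<open>d\<close>, then \<open>f(H)\<close> arises by replacing \<open>d\<close> with
  \<open>f \<circ> d\<close>; square roots and generalized inverses are obtained in this way.
\<close>

definition spectral_mat :: "nat \<Rightarrow> complex mat \<Rightarrow> (nat \<Rightarrow> real) \<Rightarrow> complex mat" where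
  "spectral_mat n U d = U * real_diag n d * mat_adjoint U"

lemma spectral_mat_carrier [simp]: "unitary n U \<Longrightarrow> spectral_mat n U d \<in> carrier_mat n n"
  unfolding spectral_mat_def
  by (intro mult_carrier_mat[of _ n n] real_diag_carrier mat_adjoint_carrier unitary_carrier)

lemma spectral_mat_index:
  assumes U: "unitary n U" and "i < n" "j < n"
  shows "spectral_mat n U d $$ (i, j) = (\<Sum>l<n. of_real (d l) * U $$ (i, l) * cnj (U $$ (j, l)))"
proof -
  note U' = unitary_carrier[OF U]
  show ?thesis
    unfolding spectral_mat_def mult_mat_sum[OF mult_carrier_mat[OF U' real_diag_carrier] mat_adjoint_carrier[OF U'] assms(2,3)]
    using U' assms by (intro sum.cong) (auto simp: mult_real_diag_index[OF U'] mult_ac simp del: index_mult_mat)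
qed

lemma real_diag_mult: "real_diag n d * real_diag n e = real_diag n (\<lambda>i. d i * e i)"
  by (rule eq_matI)
    (auto simp: mult_real_diag_index[OF real_diag_carrier] simp del: index_mult_mat(1), auto simp: real_diag_def)

lemma real_diag_adjoint [simp]: "mat_adjoint (real_diag n d) = real_diag n d"
  by (rule eq_matI) (auto simp: real_diag_def)

lemma spectral_mat_mult:
  assumes U: "unitary n U"
  shows "spectral_mat n U d * spectral_mat n U e = spectral_mat n U (\<lambda>i. d i * e i)"
proof -
  note U' = unitary_carrier[OF U]
  note c = U' mat_adjoint_carrier[OF U'] mult_carrier_mat[of _ n n _ n] real_diag_carrier[of n]
  have UU: "mat_adjoint U * U = 1\<^sub>m n" using U by (simp add: unitary_def)
  have "spectral_mat n U d * spectral_mat n U e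
      = U * real_diag n d * ((mat_adjoint U * U) * real_diag n e) * mat_adjoint U"
    unfolding spectral_mat_def by (simp add: c assoc_square[of _ n])
  also have "\<dots> = U * (real_diag n d * real_diag n e) * mat_adjoint U"
    unfolding UU left_mult_one_mat[OF real_diag_carrier] by (simp add: c assoc_square[of _ n])
  finally show ?thesis by (simp add: real_diag_mult spectral_mat_def)
qed

text \<open>
  With \<open>S\<close> the diagonal matrix of the \<open>\<surd>d\<^sub>i\<close>, this is the Gram matrix of \<open>S U\<^sup>*\<close>.
\<close>

lemma spectral_mat_psd:
  assumes U: "unitary n U" and d: "\<And>i. i < n \<Longrightarrow> 0 \<le> d i"
  shows "psd n (spectral_mat n U d)"
proof -
  note U' = unitary_carrier[OF U]
  define S where "S = real_diag n (\<lambda>i. sqrt (d i))"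
  have S: "S \<in> carrier_mat n n" by (simp add: S_def)
  have "S * S = real_diag n d"
    unfolding S_def real_diag_mult using d by (intro eq_matI) (auto simp: real_diag_def simp flip: of_real_mult)
  then have "spectral_mat n U d = U * S * (S * mat_adjoint U)"
    unfolding spectral_mat_def using assoc_square[OF U' S S]
      assoc_square[OF mult_carrier_mat[OF U' S] S mat_adjoint_carrier[OF U']] by simp
  also have "\<dots> = mat_adjoint (S * mat_adjoint U) * (S * mat_adjoint U)"
    using mat_adjoint_mult[OF S mat_adjoint_carrier[OF U']] by (simp add: S_def)
  finally show ?thesis using gram_psd[OF mult_carrier_mat[OF S mat_adjoint_carrier[OF U']]] by simp
qed

lemma unitary_col_norm:
  assumes U: "unitary n U" and i: "i < n"
  shows "sq_norm2 (col U i) = 1"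
proof -
  have "of_real (sq_norm2 (col U i)) = (1\<^sub>m n :: complex mat) $$ (i, i)"
    using gram_index[OF unitary_carrier[OF U] i i] U by (simp add: unitary_def cscalar_prod_self)
  then show ?thesis using i by simp
qed

lemma diagonalized_col:
  assumes U: "U \<in> carrier_mat n n" and H: "H \<in> carrier_mat n n"
    and HU: "H * U = U * real_diag n d" and i: "i < n"
  shows "H *\<^sub>v col U i = of_real (d i) \<cdot>\<^sub>v col U i"
proof -
  have "H *\<^sub>v col U i = col (U * real_diag n d) i" using col_mult2[OF H U i] HU by simp
  also have "\<dots> = of_real (d i) \<cdot>\<^sub>v col U i"
    using U i by (intro eq_vecI) (auto simp: mult_real_diag_index[OF U] simp del: index_mult_mat(1))
  finally show ?thesis .
qed

lemma psd_spectral: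
  assumes H: "psd n H"
  shows "\<exists>U d. unitary n U \<and> (\<forall>i<n. 0 \<le> d i) \<and> H = spectral_mat n U d"
proof -
  have H': "H \<in> carrier_mat n n" "hermitian H" using H by (auto simp: psd_def)
  obtain U d where U: "unitary n U" and HU: "H * U = U * real_diag n d"
    using hermitian_spectral[OF H'] by blast
  note U' = unitary_carrier[OF U]
  have "0 \<le> d i" if i: "i < n" for i
  proof -
    have c: "col U i \<in> carrier_vec n" using U' by (simp add: carrier_vecI)
    have "(H *\<^sub>v col U i) \<bullet>c col U i = of_real (d i * sq_norm2 (col U i))"
      unfolding diagonalized_col[OF U' H'(1) HU i]
      using smult_scalar_prod_distrib[OF c, of "conjugate (col U i)"] c by (simp add: cscalar_prod_self)
    then show ?thesis using H c unitary_col_norm[OF U i] by (auto simp: psd_def dest!: bspec[of _ _ "col U i"])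
  qed
  moreover have "H = spectral_mat n U d"
    unfolding spectral_mat_def HU[symmetric] assoc_square[OF H'(1) U' mat_adjoint_carrier[OF U']]
    using unitary_right[OF U] H' by simp
  ultimately show ?thesis using U by blast
qed

lemma sq_norm2_add_real_smult:
  assumes x: "x \<in> carrier_vec n" and y: "y \<in> carrier_vec n"
  shows "sq_norm2 (x + of_real l \<cdot>\<^sub>v y) = sq_norm2 x + 2 * l * Re (x \<bullet>c y) + l\<^sup>2 * sq_norm2 y"
proof -
  have "(cmod (x $ i + of_real l * y $ i))\<^sup>2 = (cmod (x $ i))\<^sup>2 + 2 * l * Re (x $ i * cnj (y $ i)) + l\<^sup>2 * (cmod (y $ i))\<^sup>2" for i
    unfolding cmod_power2 by (simp add: power2_eq_square algebra_simps)
  then have "sq_norm2 (x + of_real l \<cdot>\<^sub>v y) =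
      (\<Sum>i<n. (cmod (x $ i))\<^sup>2 + 2 * l * Re (x $ i * cnj (y $ i)) + l\<^sup>2 * (cmod (y $ i))\<^sup>2)"
    unfolding sq_norm2_def using x y by (intro sum.cong) auto
  then show ?thesis
    using x y unfolding sum.distrib cscalar_prod_sum[OF x y] sq_norm2_def Re_sum
    by (simp add: sum_distrib_left sum.distrib distrib_left)
qed

text \<open>
  Squares enter only through \<open>\<parallel>R u\<parallel> = \<parallel>S u\<parallel>\<close>. Expanding \<open>\<parallel>S u + l u\<parallel>\<^sup>2\<close> gives
  \<open>l (2 u\<^sup>* S u + l \<parallel>u\<parallel>\<^sup>2) = 0\<close>, and the second factor is positive for \<open>l > 0\<close>.
\<close>

lemma psd_square_eq_eigenvalue_le:
  assumes R: "psd n R" and S: "psd n S" and eq: "R * R = S * S"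
    and u: "u \<in> carrier_vec n" "u \<noteq> 0\<^sub>v n" and Ru: "R *\<^sub>v u = S *\<^sub>v u + of_real l \<cdot>\<^sub>v u"
  shows "l \<le> 0"
proof -
  have R': "R \<in> carrier_mat n n" "mat_adjoint R = R" and S': "S \<in> carrier_mat n n" "mat_adjoint S = S"
    using R S by (auto simp: psd_def hermitian_def)
  have Su: "S *\<^sub>v u \<in> carrier_vec n" using S' u by simp
  have "(R *\<^sub>v u) \<bullet>c (R *\<^sub>v u) = (S *\<^sub>v u) \<bullet>c (S *\<^sub>v u)"
    using gram_inner[OF R'(1) u(1) u(1)] gram_inner[OF S'(1) u(1) u(1)] eq R'(2) S'(2) by simp
  then have "sq_norm2 (R *\<^sub>v u) = sq_norm2 (S *\<^sub>v u)" unfolding cscalar_prod_self of_real_eq_iff .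
  then have "l * (2 * Re ((S *\<^sub>v u) \<bullet>c u) + l * sq_norm2 u) = 0"
    unfolding Ru sq_norm2_add_real_smult[OF Su u(1)] by (simp add: algebra_simps power2_eq_square)
  moreover have "0 \<le> Re ((S *\<^sub>v u) \<bullet>c u)" using S u by (simp add: psd_def)
  moreover have "0 < sq_norm2 u"
    using u sq_norm2_eq_0_iff[OF u(1)] by (simp add: sq_norm2_def sum_nonneg less_le)
  ultimately show ?thesis
    by (smt (verit) mult_pos_pos mult_eq_0_iff)
qed

text \<open>
  Exchanging \<open>R\<close> and \<open>S\<close> in the previous lemma shows that the Hermitian matrix \<open>R - S\<close> has no
  eigenvalue other than 0.
\<close>

lemma psd_square_inj:
  assumes R: "psd n R" and S: "psd n S" and eq: "R * R = S * S"
  shows "R = S"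
proof -
  have R': "R \<in> carrier_mat n n" "mat_adjoint R = R" and S': "S \<in> carrier_mat n n" "mat_adjoint S = S"
    using R S by (auto simp: psd_def hermitian_def)
  define D where "D = R - S"
  have D: "D \<in> carrier_mat n n" using R' S' by (auto simp: D_def)
  have "cnj (D $$ (j, i)) = D $$ (i, j)" if "i < n" "j < n" for i j
    using arg_cong[OF R'(2), of "\<lambda>X. X $$ (i, j)"] arg_cong[OF S'(2), of "\<lambda>X. X $$ (i, j)"] that R'(1) S'(1)
    by (simp add: D_def)
  then have "hermitian D" unfolding hermitian_def using D by (intro eq_matI) auto
  then obtain U d where U: "unitary n U" and DU: "D * U = U * real_diag n d"
    using hermitian_spectral[OF D] by blast
  note U' = unitary_carrier[OF U]
  have "d i = 0" if i: "i < n" for i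
  proof -
    define u where "u = col U i"
    have u: "u \<in> carrier_vec n" using U' by (simp add: carrier_vecI u_def)
    have u0: "u \<noteq> 0\<^sub>v n" using unitary_col_norm[OF U i] sq_norm2_eq_0_iff[OF u] by (auto simp: u_def)
    have Du: "R *\<^sub>v u - S *\<^sub>v u = of_real (d i) \<cdot>\<^sub>v u"
      using diagonalized_col[OF U' D DU i] minus_mult_distrib_mat_vec[OF R'(1) S'(1) u] by (simp add: D_def u_def)
    have "(R *\<^sub>v u) $ j - (S *\<^sub>v u) $ j = of_real (d i) * u $ j" if "j < n" for j
      using arg_cong[OF Du, of "\<lambda>v. v $ j"] that R'(1) S'(1) u by simp
    then have "R *\<^sub>v u = S *\<^sub>v u + of_real (d i) \<cdot>\<^sub>v u" "S *\<^sub>v u = R *\<^sub>v u + of_real (- d i) \<cdot>\<^sub>v u"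
      using R'(1) S'(1) u by (auto intro!: eq_vecI simp: algebra_simps simp del: index_mult_mat_vec)
    from psd_square_eq_eigenvalue_le[OF R S eq u u0 this(1)]
      psd_square_eq_eigenvalue_le[OF S R eq[symmetric] u u0 this(2)]
    show ?thesis by simp
  qed
  then have "real_diag n d = 0\<^sub>m n n" by (intro eq_matI) (auto simp: real_diag_def)
  then have "D * U * mat_adjoint U = 0\<^sub>m n n" unfolding DU using U' by simp
  then have "D = 0\<^sub>m n n" unfolding assoc_square[OF D U' mat_adjoint_carrier[OF U']] unitary_right[OF U] using D by simp
  moreover have "R $$ (i, j) - S $$ (i, j) = D $$ (i, j)" if "i < n" "j < n" for i j
    using that R'(1) S'(1) by (simp add: D_def)
  ultimately have "R $$ (i, j) - S $$ (i, j) = 0" if "i < n" "j < n" for i j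
    using that by simp
  then show ?thesis using R'(1) S'(1) by (intro eq_matI) auto
qed

text \<open>
  Existence and uniqueness of the root, which the definite description in \<^const>\<open>psd_sqrt\<close> presupposes.
\<close>

lemma psd_sqrt:
  assumes H: "psd n H"
  shows "psd n (psd_sqrt n H)" "psd_sqrt n H * psd_sqrt n H = H"
proof -
  obtain U d where U: "unitary n U" and d: "\<And>i. i < n \<Longrightarrow> 0 \<le> d i" and Heq: "H = spectral_mat n U d"
    using psd_spectral[OF H] by blast
  have R: "psd n (spectral_mat n U (\<lambda>i. sqrt (d i)))" using spectral_mat_psd[OF U] d by simp
  have RR: "spectral_mat n U (\<lambda>i. sqrt (d i)) * spectral_mat n U (\<lambda>i. sqrt (d i)) = H"
    unfolding spectral_mat_mult[OF U] Heq using d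
    by (intro eq_matI) (auto simp: spectral_mat_index[OF U] spectral_mat_carrier[OF U, THEN carrier_matD(1)]
        spectral_mat_carrier[OF U, THEN carrier_matD(2)] intro!: sum.cong simp flip: of_real_mult)
  have "\<exists>!R. psd n R \<and> R * R = H" using R RR psd_square_inj by metis
  from theI'[OF this] show "psd n (psd_sqrt n H)" "psd_sqrt n H * psd_sqrt n H = H"
    by (auto simp: psd_sqrt_def)
qed

lemma psd_sqrt_gram:
  assumes H: "psd n H"
  shows "psd_sqrt n H \<in> carrier_mat n n" "mat_adjoint (psd_sqrt n H) * psd_sqrt n H = H"
  using psd_sqrt[OF H] by (auto simp: psd_def hermitian_def)

section \<open>Range and rank of a Gram matrix\<close>

lemma range_mat_alt: "A \<in> carrier_mat m n \<Longrightarrow> range_mat A = {A *\<^sub>v x | x. x \<in> carrier_vec n}"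
  by (auto simp: range_mat_def)

text \<open>
  The convention \<open>inverse 0 = 0\<close> turns \<open>\<lambda>i. inverse (d i)\<close> into the eigenvalues of the pseudo-inverse.
\<close>

lemma psd_generalized_inverse:
  assumes H: "psd n H"
  shows "\<exists>G \<in> carrier_mat n n. H * G * H = H"
proof -
  obtain U d where U: "unitary n U" and Heq: "H = spectral_mat n U d"
    using psd_spectral[OF H] by blast
  have "(\<lambda>i. d i * inverse (d i) * d i) = d"
    by (auto simp: fun_eq_iff field_simps)
  then have "H * spectral_mat n U (\<lambda>i. inverse (d i)) * H = H"
    unfolding Heq spectral_mat_mult[OF U] by simp
  then show ?thesis using spectral_mat_carrier[OF U] by blast
qed

text \<open>
  For a generalized inverse \<open>G\<close> of \<open>H = C\<^sup>* C\<close>, the matrix \<open>N = 1 - G H\<close> satisfies \<open>H N = 0\<close>. Hence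
  \<open>(C N)\<^sup>* (C N) = 0\<close>, and so \<open>C N = 0\<close>.
\<close>

lemma gram_generalized_inverse:
  fixes C :: "complex mat"
  assumes C: "C \<in> carrier_mat m n"
  shows "\<exists>G \<in> carrier_mat n n. C * (G * (mat_adjoint C * C)) = C"
proof -
  define H where "H = mat_adjoint C * C"
  have H: "H \<in> carrier_mat n n" using C by (auto simp: H_def)
  obtain G where G: "G \<in> carrier_mat n n" and HGH: "H * G * H = H"
    using psd_generalized_inverse[OF gram_psd[OF C]] by (auto simp: H_def)
  have GH: "G * H \<in> carrier_mat n n" using G H by auto
  define N where "N = 1\<^sub>m n - G * H"
  have N: "N \<in> carrier_mat n n" using minus_carrier_mat[OF GH] by (simp add: N_def)
  have "H * N = H * 1\<^sub>m n - H * (G * H)"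
    unfolding N_def by (rule mult_minus_distrib_mat[OF H one_carrier_mat GH])
  then have HN: "H * N = 0\<^sub>m n n"
    using assoc_square[OF H G H] HGH H by (simp add: minus_r_inv_mat[OF H])
  have CN: "C * N \<in> carrier_mat m n" using C N by auto
  have "mat_adjoint (C * N) * (C * N) = mat_adjoint N * (mat_adjoint C * (C * N))"
    unfolding mat_adjoint_mult[OF C N]
    by (rule assoc_mult_mat[OF mat_adjoint_carrier[OF N] mat_adjoint_carrier[OF C] CN])
  also have "mat_adjoint C * (C * N) = H * N"
    unfolding H_def using assoc_mult_mat[OF mat_adjoint_carrier[OF C] C N] by simp
  also have "mat_adjoint N * (H * N) = 0\<^sub>m n n"
    unfolding HN using right_mult_zero_mat[OF mat_adjoint_carrier[OF N]] .
  finally have CN0: "C * N = 0\<^sub>m m n" using gram_eq_0_imp_eq_0[OF CN] by simp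
  have "C * N = C * 1\<^sub>m n - C * (G * H)"
    unfolding N_def by (rule mult_minus_distrib_mat[OF C one_carrier_mat GH])
  then have eq: "C - C * (G * H) = 0\<^sub>m m n" using CN0 C by simp
  have "C * (G * H) = C"
  proof (rule eq_matI)
    fix i j assume ij: "i < dim_row C" "j < dim_col C"
    have "(C - C * (G * H)) $$ (i, j) = C $$ (i, j) - (C * (G * H)) $$ (i, j)"
      by (rule index_minus_mat) (use ij C GH in auto)
    then show "(C * (G * H)) $$ (i, j) = C $$ (i, j)" unfolding eq using ij C by simp
  qed (use C G H in auto)
  then show ?thesis using G unfolding H_def by blast
qed

text \<open>
  Taking adjoints in \<open>C = C G (C\<^sup>* C)\<close> gives \<open>C\<^sup>* = (C\<^sup>* C) G\<^sup>* C\<^sup>*\<close>.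
\<close>

lemma range_gram:
  fixes C :: "complex mat"
  assumes C: "C \<in> carrier_mat m n"
  shows "range_mat (mat_adjoint C * C) = range_mat (mat_adjoint C)"
proof
  note aC = mat_adjoint_carrier[OF C]
  have H: "mat_adjoint C * C \<in> carrier_mat n n" using C by auto
  show "range_mat (mat_adjoint C * C) \<subseteq> range_mat (mat_adjoint C)"
    unfolding range_mat_alt[OF H] range_mat_alt[OF aC]
    using assoc_mult_mat_vec[OF aC C] mult_mat_vec_carrier[OF C] by auto
  obtain G where G: "G \<in> carrier_mat n n" and CGH: "C * (G * (mat_adjoint C * C)) = C"
    using gram_generalized_inverse[OF C] by blast
  have GH: "G * (mat_adjoint C * C) \<in> carrier_mat n n" using G H by auto
  have "mat_adjoint C = mat_adjoint (G * (mat_adjoint C * C)) * mat_adjoint C"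
    using mat_adjoint_mult[OF C GH] CGH by simp
  also have "mat_adjoint (G * (mat_adjoint C * C)) = (mat_adjoint C * C) * mat_adjoint G"
    using mat_adjoint_mult[OF G H] mat_adjoint_mult[OF aC C] by simp
  finally have eq: "mat_adjoint C = (mat_adjoint C * C) * mat_adjoint G * mat_adjoint C" .
  show "range_mat (mat_adjoint C) \<subseteq> range_mat (mat_adjoint C * C)"
  proof
    fix y assume "y \<in> range_mat (mat_adjoint C)"
    then obtain x where x: "x \<in> carrier_vec m" and y: "y = mat_adjoint C *\<^sub>v x"
      unfolding range_mat_alt[OF aC] by blast
    have "y = (mat_adjoint C * C) *\<^sub>v (mat_adjoint G *\<^sub>v (mat_adjoint C *\<^sub>v x))"
      unfolding y by (subst eq)
        (simp add: assoc_mult_mat_vec[OF mult_carrier_mat[OF H mat_adjoint_carrier[OF G]] aC x]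
          assoc_mult_mat_vec[OF H mat_adjoint_carrier[OF G] mult_mat_vec_carrier[OF aC x]])
    then show "y \<in> range_mat (mat_adjoint C * C)"
      unfolding range_mat_alt[OF H]
      using mult_mat_vec_carrier[OF mat_adjoint_carrier[OF G] mult_mat_vec_carrier[OF aC x]] by blast
  qed
qed

text \<open>
  The span of the columns, whose dimension is the rank, is the range.
\<close>

lemma rank_eq_of_range_eq:
  fixes A B :: "complex mat"
  assumes A: "A \<in> carrier_mat n k" and B: "B \<in> carrier_mat n l" and eq: "range_mat A = range_mat B"
  shows "vec_space.rank n A = vec_space.rank n B"
proof -
  interpret vec_space "TYPE(complex)" n .
  have "span (set (cols M)) = range_mat M" if "M \<in> carrier_mat n m" for M m
    using col_space_eq[OF that] that mult_mat_vec_carrier[OF that]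
    unfolding col_space_def range_mat_alt[OF that] by auto
  from this[OF A] this[OF B] show ?thesis unfolding rank_def eq by simp
qed

lemma rank_gram:
  fixes C :: "complex mat"
  assumes C: "C \<in> carrier_mat m n"
  shows "vec_space.rank n (mat_adjoint C * C) = vec_space.rank n (mat_adjoint C)"
  using rank_eq_of_range_eq[OF mult_carrier_mat[OF mat_adjoint_carrier[OF C] C] mat_adjoint_carrier[OF C] range_gram[OF C]] .

lemma rank_gram_le:
  fixes C :: "complex mat"
  assumes C: "C \<in> carrier_mat m n"
  shows "vec_space.rank n (mat_adjoint C * C) \<le> m"
  unfolding rank_gram[OF C] by (rule vec_space.rank_le_nc[OF mat_adjoint_carrier[OF C]])

text \<open>
  A vector in the kernel is annihilated by the Gram matrix of the columns, which is diagonal with nonzero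
  diagonal entries.
\<close>

lemma orthogonal_cols_full_rank:
  fixes A :: "complex mat"
  assumes A: "A \<in> carrier_mat n r"
    and orth: "\<And>i j. i < r \<Longrightarrow> j < r \<Longrightarrow> col A i \<bullet>c col A j = 0 \<longleftrightarrow> i \<noteq> j"
  shows "vec_space.rank n A = r"
proof -
  interpret vec_space "TYPE(complex)" n .
  have dist: "distinct (cols A)"
    unfolding distinct_conv_nth using A orth by (auto, metis)
  have "lin_indpt (set (cols A))"
  proof (rule ccontr)
    assume "\<not> lin_indpt (set (cols A))"
    then obtain v where v: "v \<in> carrier_vec r" "v \<noteq> 0\<^sub>v r" and Av: "A *\<^sub>v v = 0\<^sub>v n"
      using lin_depE[OF A _ dist] by blast
    have "v $ i = 0" if i: "i < r" for i
    proof -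
      have G: "mat_adjoint A * A \<in> carrier_mat r r" using A by auto
      have "(mat_adjoint A * A) *\<^sub>v v = 0\<^sub>v r"
        unfolding assoc_mult_mat_vec[OF mat_adjoint_carrier[OF A] A v(1)] Av using A by (intro eq_vecI) auto
      then have "0 = (\<Sum>j<r. (mat_adjoint A * A) $$ (i, j) * v $ j)"
        using mult_mat_vec_sum[OF G v(1) i] i by simp
      also have "\<dots> = (\<Sum>j<r. if j = i then (col A i \<bullet>c col A i) * v $ i else 0)"
        using i by (intro sum.cong) (auto simp: gram_index[OF A] orth simp del: index_mult_mat(1))
      finally show ?thesis using i orth[OF i i] by simp
    qed
    then have "v = 0\<^sub>v r" using v(1) by (intro eq_vecI) auto
    then show False using v by simp
  qed
  then show ?thesis using lin_indpt_full_rank[OF A dist] by simp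
qed

text \<open>
  In \<open>H = \<Sum>\<^sub>i d\<^sub>i u\<^sub>i u\<^sub>i\<^sup>*\<close> only the nonzero eigenvalues matter. The rows \<open>\<surd>d\<^sub>i u\<^sub>i\<^sup>*\<close> that belong to them are
  orthogonal, so that their number is the rank.
\<close>

lemma psd_minimal_factorization:
  assumes H: "psd n H"
  shows "\<exists>C \<in> carrier_mat (vec_space.rank n H) n. mat_adjoint C * C = H"
proof -
  obtain U d where U: "unitary n U" and d: "\<And>i. i < n \<Longrightarrow> 0 \<le> d i" and Heq: "H = spectral_mat n U d"
    using psd_spectral[OF H] by blast
  note U' = unitary_carrier[OF U]
  define M where "M = {i. i < n \<and> d i \<noteq> 0}"
  define r where "r = card M"
  have finM: "finite M" by (simp add: M_def)
  \<comment> \<open>The rows of \<open>C\<close> are indexed by an enumeration of the nonzero eigenvalues.\<close>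
  obtain h where "bij_betw h {0..<r} M" using ex_bij_betw_nat_finite[OF finM] by (auto simp: r_def)
  then have h: "bij_betw h {..<r} M" by (simp add: lessThan_atLeast0)
  have hM: "h a < n" "d (h a) \<noteq> 0" if "a < r" for a using bij_betwE[OF h] that by (auto simp: M_def)
  define C where "C = mat r n (\<lambda>(a, j). of_real (sqrt (d (h a))) * cnj (U $$ (j, h a)))"
  have C: "C \<in> carrier_mat r n" by (simp add: C_def)
  have CC: "mat_adjoint C * C = H"
  proof (rule eq_matI)
    fix j k assume "j < dim_row H" "k < dim_col H"
    then have jk: "j < n" "k < n" using H by (auto simp: psd_def)
    have "(mat_adjoint C * C) $$ (j, k) = (\<Sum>a<r. of_real (d (h a)) * U $$ (j, h a) * cnj (U $$ (k, h a)))"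
      unfolding mult_mat_sum[OF mat_adjoint_carrier[OF C] C jk]
    proof (intro sum.cong refl)
      fix a assume "a \<in> {..<r}"
      then have "complex_of_real (sqrt (d (h a))) * of_real (sqrt (d (h a))) = of_real (d (h a))" "a < r"
        using d hM by (auto simp flip: of_real_mult)
      then show "mat_adjoint C $$ (j, a) * C $$ (a, k) = of_real (d (h a)) * U $$ (j, h a) * cnj (U $$ (k, h a))"
        using C jk by (simp add: C_def mult_ac)
    qed
    also have "\<dots> = (\<Sum>i\<in>M. of_real (d i) * U $$ (j, i) * cnj (U $$ (k, i)))"
      by (rule sum.reindex_bij_betw[OF h])
    also have "\<dots> = (\<Sum>i<n. of_real (d i) * U $$ (j, i) * cnj (U $$ (k, i)))"
      by (rule sum.mono_neutral_left) (auto simp: M_def)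
    finally show "(mat_adjoint C * C) $$ (j, k) = H $$ (j, k)"
      unfolding Heq spectral_mat_index[OF U jk] .
  qed (use H C in \<open>auto simp: psd_def\<close>)
  have "col (mat_adjoint C) a = of_real (sqrt (d (h a))) \<cdot>\<^sub>v col U (h a)" if "a < r" for a
    using that U' C hM(1)[OF that] by (intro eq_vecI) (auto simp: C_def)
  moreover have cU: "col U i \<in> carrier_vec n" for i using U' by (simp add: carrier_vecI)
  ultimately have "col (mat_adjoint C) a \<bullet>c col (mat_adjoint C) b
      = of_real (sqrt (d (h a)) * sqrt (d (h b))) * (1\<^sub>m n $$ (h b, h a))" if "a < r" "b < r" for a b
    using that hM(1) gram_index[OF U' hM(1)[OF that(2)] hM(1)[OF that(1)]] U
    by (simp add: conjugate_smult_vec unitary_def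
        smult_scalar_prod_distrib[OF cU] scalar_prod_smult_distrib[OF cU carrier_vec_conjugate[OF cU]])
  moreover have "h a = h b \<longleftrightarrow> a = b" if "a < r" "b < r" for a b
    using bij_betw_imp_inj_on[OF h] that by (auto simp: inj_on_def)
  ultimately have "col (mat_adjoint C) a \<bullet>c col (mat_adjoint C) b = 0 \<longleftrightarrow> a \<noteq> b" if "a < r" "b < r" for a b
    using that hM by auto
  then have "vec_space.rank n H = r"
    using orthogonal_cols_full_rank[OF mat_adjoint_carrier[OF C]] rank_gram[OF C] CC by simp
  then show ?thesis using C CC by blast
qed

text \<open>
  As \<open>x\<^sup>* H x = \<parallel>H\<^sup>1\<^sup>/\<^sup>2 x\<parallel>\<^sup>2\<close>, the form of \<open>H\<close> vanishes exactly on the kernel of \<open>H\<close>.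
\<close>

lemma psd_full_rank_iff_pos_def:
  assumes H: "psd n H"
  shows "vec_space.rank n H = n \<longleftrightarrow> pos_def n H"
proof -
  have H': "H \<in> carrier_mat n n" "hermitian H" using H by (auto simp: psd_def)
  have "vec_space.rank n H = n \<longleftrightarrow> det H \<noteq> 0" using vec_space.det_rank_iff[OF H'(1)] by simp
  also have "\<dots> \<longleftrightarrow> (\<forall>x \<in> carrier_vec n. x \<noteq> 0\<^sub>v n \<longrightarrow> H *\<^sub>v x \<noteq> 0\<^sub>v n)"
    using det_0_iff_vec_prod_zero_field[OF H'(1)] by blast
  also have "\<dots> \<longleftrightarrow> pos_def n H"
  proof -
    note R = psd_sqrt_gram[OF H]
    have "H *\<^sub>v x = 0\<^sub>v n \<longleftrightarrow> Re ((H *\<^sub>v x) \<bullet>c x) = 0" if x: "x \<in> carrier_vec n" for x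
    proof
      assume "Re ((H *\<^sub>v x) \<bullet>c x) = 0"
      then have "psd_sqrt n H *\<^sub>v x = 0\<^sub>v n"
        using gram_inner[OF R(1) x x] sq_norm2_eq_0_iff[OF mult_mat_vec_carrier[OF R(1) x]]
        by (simp add: R(2) cscalar_prod_self)
      then show "H *\<^sub>v x = 0\<^sub>v n"
        using assoc_mult_mat_vec[OF mat_adjoint_carrier[OF R(1)] R(1) x]
          mult_mat_vec_sum[OF mat_adjoint_carrier[OF R(1)], of "0\<^sub>v n"] R(1)
        by (intro eq_vecI) (auto simp del: index_mult_mat_vec simp: R(2))
    qed (use x in simp)
    then show ?thesis using H unfolding psd_def pos_def_def by (metis less_le)
  qed
  finally show ?thesis .
qed

lemma full_rank_iff_range:
  fixes A :: "complex mat"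
  assumes A: "A \<in> carrier_mat n n"
  shows "vec_space.rank n A = n \<longleftrightarrow> range_mat A = carrier_vec n"
proof
  assume "range_mat A = carrier_vec n"
  moreover have "range_mat (1\<^sub>m n :: complex mat) = carrier_vec n"
    unfolding range_mat_alt[OF one_carrier_mat] by force
  ultimately have "vec_space.rank n A = vec_space.rank n (1\<^sub>m n :: complex mat)"
    by (intro rank_eq_of_range_eq[OF A one_carrier_mat]) simp
  then show "vec_space.rank n A = n"
    using vec_space.det_rank_iff[OF one_carrier_mat[where 'a = complex], of n] by simp
next
  assume "vec_space.rank n A = n"
  then have "det A \<noteq> 0" using vec_space.det_rank_iff[OF A] by simp
  then obtain B where B: "B \<in> carrier_mat n n" "A * B = 1\<^sub>m n"
    using det_non_zero_imp_unit[OF A, of "()"] by (auto simp: Units_def ring_mat_def)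
  have "y \<in> range_mat A" if y: "y \<in> carrier_vec n" for y
  proof -
    have "y = A *\<^sub>v (B *\<^sub>v y)" using assoc_mult_mat_vec[OF A B(1) y] B y by simp
    then show ?thesis unfolding range_mat_alt[OF A] using mult_mat_vec_carrier[OF B(1) y] by blast
  qed
  then show "range_mat A = carrier_vec n"
    unfolding range_mat_alt[OF A] using mult_mat_vec_carrier[OF A] by blast
qed

section \<open>Polynomials without constant term of degree at most three\<close>

lemma const2_mult_monom: "const2 c * monom (monom w a) b = monom (monom (c * w) a) b"
  by (simp add: const2_def smult_monom)

lemma monomial_eq_monom: "const2 c * Z1 ^ a * Z2 ^ b = monom (monom c a) b"
proof -
  have 1: "Z1 ^ a = monom (monom 1 a) 0"
    by (induction a) (simp_all add: Z1_def monom_0 one_pCons monom_Suc)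
  have 2: "Z2 ^ b = monom 1 b"
    by (induction b) (simp_all add: Z2_def monom_0 monom_Suc flip: one_pCons)
  show ?thesis unfolding 1 2 const2_mult_monom by (simp add: mult_monom)
qed

definition mono_exponent :: "nat \<Rightarrow> nat \<times> nat" where
  "mono_exponent k = [(1, 0), (0, 1), (2, 0), (1, 1), (0, 2), (3, 0), (2, 1), (1, 2), (0, 3)] ! k"

definition mono_weight :: "nat \<Rightarrow> complex" where
  "mono_weight k = [1, 1, 1, of_real (sqrt 2), 1, 1, of_real (sqrt 3), of_real (sqrt 3), 1] ! k"

lemma less_9_cases: "(k :: nat) < 9 \<longleftrightarrow> k \<in> {0, 1, 2, 3, 4, 5, 6, 7, 8}"
  by auto

lemma V_mono_dim [simp]: "dim_vec V_mono = 9"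
  unfolding V_mono_def dim_vec_of_list by simp

lemma V_mono_carrier [simp]: "V_mono \<in> carrier_vec 9"
  by (rule carrier_vecI) simp

lemma V_mono_index:
  assumes "k < 9"
  shows "V_mono $ k = monom (monom (mono_weight k) (fst (mono_exponent k))) (snd (mono_exponent k))"
  unfolding monomial_eq_monom[symmetric]
  using assms unfolding less_9_cases V_mono_def
  by (auto simp: vec_of_list_index mono_weight_def mono_exponent_def const2_hom
      simp del: vec_of_list_Cons)

lemma mono_weight_nonzero: "k < 9 \<Longrightarrow> mono_weight k \<noteq> 0"
  unfolding less_9_cases by (auto simp: mono_weight_def)

lemma inj_mono_exponent: "inj_on mono_exponent {..<9}"
  unfolding mono_exponent_def by (rule inj_on_nth) auto

lemma range_mono_exponent: "mono_exponent ` {..<9} = {(a, b). 1 \<le> a + b \<and> a + b \<le> 3}"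
proof -
  have "(a, b) \<in> mono_exponent ` {..<9} \<longleftrightarrow> 1 \<le> a + b \<and> a + b \<le> 3" for a b
  proof
    assume "(a, b) \<in> mono_exponent ` {..<9}"
    then show "1 \<le> a + b \<and> a + b \<le> 3"
      unfolding image_iff Bex_def lessThan_iff less_9_cases by (auto simp: mono_exponent_def)
  next
    assume "1 \<le> a + b \<and> a + b \<le> 3"
    then have "a \<in> {0, 1, 2, 3} \<and> b \<in> {0, 1, 2, 3} \<and> 1 \<le> a + b \<and> a + b \<le> 3" by auto
    then have "\<exists>k \<in> {0, 1, 2, 3, 4, 5, 6, 7, 8}. (a, b) = mono_exponent k"
      by (auto simp: mono_exponent_def)
    then show "(a, b) \<in> mono_exponent ` {..<9}"
      unfolding image_iff Bex_def lessThan_iff less_9_cases .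
  qed
  then show ?thesis by auto
qed

lemma mono_exponent_cubic: "k < 9 \<Longrightarrow> fst (mono_exponent k) + snd (mono_exponent k) = 3 \<longleftrightarrow> 5 \<le> k"
  unfolding less_9_cases by (auto simp: mono_exponent_def)

definition mono_comb :: "(nat \<Rightarrow> complex) \<Rightarrow> bpoly" where
  "mono_comb c = (\<Sum>k<9. const2 (c k) * V_mono $ k)"

lemma coeff_mono_comb:
  "coeff (coeff (mono_comb c) b) a = (\<Sum>k<9. if mono_exponent k = (a, b) then c k * mono_weight k else 0)"
  unfolding mono_comb_def coeff_sum
  by (intro sum.cong) (auto simp: V_mono_index const2_mult_monom prod_eq_iff)

lemma coeff_mono_comb_exponent:
  assumes k: "k < 9"
  shows "coeff (coeff (mono_comb c) (snd (mono_exponent k))) (fst (mono_exponent k)) = c k * mono_weight k"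
proof -
  have "coeff (coeff (mono_comb c) (snd (mono_exponent k))) (fst (mono_exponent k))
      = (\<Sum>l<9. if l = k then c k * mono_weight k else 0)"
    unfolding coeff_mono_comb using k inj_mono_exponent
    by (intro sum.cong) (auto simp: inj_on_def)
  then show ?thesis using k by simp
qed

lemma coeff_mono_comb_other:
  assumes "\<not> (1 \<le> a + b \<and> a + b \<le> 3)"
  shows "coeff (coeff (mono_comb c) b) a = 0"
proof -
  have "mono_exponent k \<noteq> (a, b)" if "k < 9" for k
    using range_mono_exponent assms that by (metis (mono_tags, lifting) case_prod_conv image_eqI lessThan_iff mem_Collect_eq)
  then show ?thesis unfolding coeff_mono_comb by (intro sum.neutral) auto
qed

lemma mono_comb_eq_iff: "mono_comb c = mono_comb d \<longleftrightarrow> (\<forall>k<9. c k = d k)"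
proof
  assume eq: "mono_comb c = mono_comb d"
  show "\<forall>k<9. c k = d k"
  proof (intro allI impI)
    fix k :: nat assume k: "k < 9"
    have "c k * mono_weight k = d k * mono_weight k"
      using coeff_mono_comb_exponent[OF k, of c] coeff_mono_comb_exponent[OF k, of d] unfolding eq by auto
    then show "c k = d k" using mono_weight_nonzero[OF k] by simp
  qed
qed (auto simp: mono_comb_def)

lemma mono_comb_add: "mono_comb (\<lambda>k. c k + d k) = mono_comb c + mono_comb d"
  by (simp add: mono_comb_def const2_hom distrib_right sum.distrib)

lemma mono_comb_smult: "mono_comb (\<lambda>k. a * c k) = const2 a * mono_comb c"
  unfolding mono_comb_def const2_hom sum_distrib_left mult.assoc ..

lemma const2_0 [simp]: "const2 0 = 0"
  by (simp add: const2_def)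

lemma mono_comb_0: "mono_comb (\<lambda>_. 0) = 0"
  by (simp add: mono_comb_def)

lemma mono_comb_sum: "finite A \<Longrightarrow> mono_comb (\<lambda>k. \<Sum>i\<in>A. c i k) = (\<Sum>i\<in>A. mono_comb (c i))"
  by (induction A rule: finite_induct) (simp_all add: mono_comb_0 mono_comb_add)

lemma eval2_sum: "eval2 (sum f A) z = (\<Sum>i\<in>A. eval2 (f i) z)"
  by (induction A rule: infinite_finite_induct) simp_all

lemma eval2_origin: "eval2 p (0, 0) = coeff (coeff p 0) 0"
  by (simp add: eval2_def poly_0_coeff_0)

text \<open>
  The set of exponents of a polynomial is finite, so that the \<^const>\<open>Max\<close> in the definition is attained.
\<close>

lemma total_degree_le_iff: "total_degree p \<le> n \<longleftrightarrow> (\<forall>i j. coeff (coeff p j) i \<noteq> 0 \<longrightarrow> i + j \<le> n)"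
proof -
  have "{i + j | i j. coeff (coeff p j) i \<noteq> 0}
      \<subseteq> (\<lambda>(j, i). i + j) ` (SIGMA j:{..degree p}. {..degree (coeff p j)})"
    by (force simp: le_degree intro: le_degree)
  then have "finite {i + j | i j. coeff (coeff p j) i \<noteq> 0}"
    by (rule finite_subset) auto
  then show ?thesis unfolding total_degree_def by (subst Max_le_iff) auto
qed

lemma total_degree_mono_comb_le: "total_degree (mono_comb c) \<le> 3"
  unfolding total_degree_le_iff using coeff_mono_comb_other by blast

lemma total_degree_mono_comb_cubic: "total_degree (mono_comb c) \<le> 2 \<longleftrightarrow> (\<forall>k\<in>{5..<9}. c k = 0)"
proof
  assume le: "total_degree (mono_comb c) \<le> 2"
  show "\<forall>k\<in>{5..<9}. c k = 0"
  proof
    fix k :: nat assume k: "k \<in> {5..<9}"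
    then have "fst (mono_exponent k) + snd (mono_exponent k) = 3" using mono_exponent_cubic by simp
    then have "c k * mono_weight k = 0"
      using le k coeff_mono_comb_exponent[of k c] unfolding total_degree_le_iff
      by (metis Suc_n_not_le_n add.commute atLeastLessThan_iff eval_nat_numeral(3) numeral_2_eq_2)
    then show "c k = 0" using mono_weight_nonzero k by simp
  qed
next
  assume 0: "\<forall>k\<in>{5..<9}. c k = 0"
  show "total_degree (mono_comb c) \<le> 2"
    unfolding total_degree_le_iff
  proof (intro allI impI)
    fix a b assume nz: "coeff (coeff (mono_comb c) b) a \<noteq> 0"
    then have "1 \<le> a + b \<and> a + b \<le> 3" using coeff_mono_comb_other by blast
    then obtain k where k: "k < 9" "mono_exponent k = (a, b)"
      using range_mono_exponent by (metis (mono_tags, lifting) case_prod_conv image_iff lessThan_iff mem_Collect_eq)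
    then have "c k \<noteq> 0" using nz coeff_mono_comb_exponent[of k c] by auto
    then have "\<not> 5 \<le> k" using 0 k by auto
    then show "a + b \<le> 2" using mono_exponent_cubic[of k] k \<open>1 \<le> a + b \<and> a + b \<le> 3\<close> by auto
  qed
qed

text \<open>
  Every exponent of total degree 1, 2 or 3 occurs exactly once in \<^const>\<open>V_mono\<close> and with nonzero
  weight, so that the coefficients of a polynomial determine its coordinates.
\<close>

lemma W_space_eq_range_mono_comb: "W_space = range mono_comb"
proof
  show "range mono_comb \<subseteq> W_space"
    using total_degree_mono_comb_le coeff_mono_comb_other[of 0 0] by (auto simp: W_space_def eval2_origin)
  show "W_space \<subseteq> range mono_comb"
  proof
    fix p assume p: "p \<in> W_space"
    define c where "c = (\<lambda>k. coeff (coeff p (snd (mono_exponent k))) (fst (mono_exponent k)) / mono_weight k)"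
    have "coeff (coeff p b) a = coeff (coeff (mono_comb c) b) a" for a b
    proof (cases "1 \<le> a + b \<and> a + b \<le> 3")
      case True
      then obtain k where k: "k < 9" "mono_exponent k = (a, b)"
        using range_mono_exponent by (metis (mono_tags, lifting) case_prod_conv image_iff lessThan_iff mem_Collect_eq)
      then show ?thesis
        using coeff_mono_comb_exponent[OF k(1), of c] mono_weight_nonzero[OF k(1)] by (simp add: c_def)
    next
      case False
      then have "coeff (coeff p b) a = 0"
        using p by (cases "a + b = 0") (auto simp: W_space_def eval2_origin total_degree_le_iff)
      then show ?thesis using coeff_mono_comb_other[OF False] by simp
    qed
    then have "p = mono_comb c" by (intro poly_eqI) auto
    then show "p \<in> range mono_comb" by blast
  qed
qed

section \<open>Numerators\<close>

lemma mat_act_dim [simp]: "dim_vec (mat_act A P) = dim_row A"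
  by (simp add: mat_act_def)

lemma mat_act_index:
  assumes "A \<in> carrier_mat m n" "P \<in> carrier_vec n" "i < m"
  shows "mat_act A P $ i = (\<Sum>j<n. const2 (A $$ (i, j)) * P $ j)"
  unfolding mat_act_def using assms by (auto simp: scalar_prod_def lessThan_atLeast0 intro!: sum.cong)

lemma mat_act_V_index:
  assumes "C \<in> carrier_mat m 9" "i < m"
  shows "mat_act C V_mono $ i = mono_comb (\<lambda>k. C $$ (i, k))"
  using mat_act_index[OF assms(1) V_mono_carrier assms(2)] by (simp add: mono_comb_def)

lemma mat_act_mult:
  assumes A: "A \<in> carrier_mat m n" and B: "B \<in> carrier_mat n 9"
  shows "mat_act A (mat_act B V_mono) = mat_act (A * B) V_mono"
proof (rule eq_vecI)
  have AB: "A * B \<in> carrier_mat m 9" using A B by auto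
  have BV: "mat_act B V_mono \<in> carrier_vec n" using B by (intro carrier_vecI) simp
  fix i assume "i < dim_vec (mat_act (A * B) V_mono)"
  then have i: "i < m" using A by simp
  have "mat_act A (mat_act B V_mono) $ i = (\<Sum>j<n. mono_comb (\<lambda>k. A $$ (i, j) * B $$ (j, k)))"
    unfolding mat_act_index[OF A BV i] by (intro sum.cong) (auto simp: mat_act_V_index[OF B] mono_comb_smult)
  also have "\<dots> = mono_comb (\<lambda>k. \<Sum>j<n. A $$ (i, j) * B $$ (j, k))" by (simp add: mono_comb_sum)
  also have "\<dots> = mono_comb (\<lambda>k. (A * B) $$ (i, k))"
    unfolding mono_comb_eq_iff using mult_mat_sum[OF A B i] by simp
  finally show "mat_act A (mat_act B V_mono) $ i = mat_act (A * B) V_mono $ i"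
    unfolding mat_act_V_index[OF AB i] .
qed simp

text \<open>
  Linear independence of the entries of \<^const>\<open>V_mono\<close>: identities between numerators are identities
  between matrices.
\<close>

lemma mat_act_V_inj:
  assumes A: "A \<in> carrier_mat m 9" and B: "B \<in> carrier_mat m 9" and eq: "mat_act A V_mono = mat_act B V_mono"
  shows "A = B"
proof (rule eq_matI)
  fix i k assume "i < dim_row B" "k < dim_col B"
  then have i: "i < m" and k: "k < 9" using B by auto
  have "mono_comb (\<lambda>k. A $$ (i, k)) = mono_comb (\<lambda>k. B $$ (i, k))"
    using eq mat_act_V_index[OF A i] mat_act_V_index[OF B i] by simp
  then show "A $$ (i, k) = B $$ (i, k)" unfolding mono_comb_eq_iff using k by blast
qed (use A B in auto)

lemma eval_vec_mat_act:
  assumes C: "C \<in> carrier_mat m 9"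
  shows "eval_vec (mat_act C V_mono) z = C *\<^sub>v eval_vec V_mono z"
proof (rule eq_vecI)
  have V: "eval_vec V_mono z \<in> carrier_vec 9" by (intro carrier_vecI) (simp add: eval_vec_def)
  fix i assume "i < dim_vec (C *\<^sub>v eval_vec V_mono z)"
  then have i: "i < m" using C by simp
  have "eval_vec (mat_act C V_mono) z $ i = eval2 (mono_comb (\<lambda>k. C $$ (i, k))) z"
    using C i by (simp add: eval_vec_def mat_act_V_index[OF C])
  also have "\<dots> = (C *\<^sub>v eval_vec V_mono z) $ i"
    unfolding mono_comb_def eval2_sum mult_mat_vec_sum[OF C V i] by (simp add: eval_vec_def)
  finally show "eval_vec (mat_act C V_mono) z $ i = (C *\<^sub>v eval_vec V_mono z) $ i" .
qed (use C in \<open>simp add: eval_vec_def\<close>)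

text \<open>
  This is \<open>\<parallel>C V\<parallel>\<^sup>2 = V\<^sup>* (C\<^sup>* C) V\<close>.
\<close>

lemma sphere_identity_mat_act:
  assumes C: "C \<in> carrier_mat m 9"
  shows "sphere_identity (mat_act C V_mono) g \<longleftrightarrow> mat_adjoint C * C \<in> gram_set g"
proof -
  have V: "eval_vec V_mono z \<in> carrier_vec 9" for z by (intro carrier_vecI) (simp add: eval_vec_def)
  have "((mat_adjoint C * C) *\<^sub>v eval_vec V_mono z) \<bullet>c eval_vec V_mono z
      = of_real (sq_norm2 (eval_vec (mat_act C V_mono) z))" for z
    unfolding gram_inner[OF C V V] eval_vec_mat_act[OF C] cscalar_prod_self ..
  then show ?thesis using gram_psd[OF C] by (simp add: gram_set_def sphere_identity_def flip: of_real_power)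
qed

lemma vec_degree_le_iff: "vec_degree P \<le> n \<longleftrightarrow> (\<forall>i<dim_vec P. total_degree (P $ i) \<le> n)"
  unfolding vec_degree_def by (subst Max_le_iff) (auto simp: vec_set_def)

lemma mat_act_V_origin:
  assumes "C \<in> carrier_mat m 9"
  shows "eval_vec (mat_act C V_mono) (0, 0) = 0\<^sub>v m"
proof (rule eq_vecI)
  fix i assume "i < dim_vec (0\<^sub>v m :: complex vec)"
  then show "eval_vec (mat_act C V_mono) (0, 0) $ i = 0\<^sub>v m $ i"
    using assms coeff_mono_comb_other[of 0 0] by (simp add: eval_vec_def mat_act_V_index[OF assms] eval2_origin)
qed (use assms in \<open>simp add: eval_vec_def\<close>)

lemma mat_act_V_in_pointed_reps:
  assumes C: "C \<in> carrier_mat m 9" and g: "eval2 g (0, 0) = 1"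
  shows "mat_act C V_mono \<in> pointed_reps g \<longleftrightarrow> mat_adjoint C * C \<in> gram_set g"
  using C g mat_act_V_origin[OF C] sphere_identity_mat_act[OF C]
  by (auto simp: pointed_reps_def pointed_def vec_degree_le_iff mat_act_V_index[OF C] total_degree_mono_comb_le)

lemma pointed_reps_factor:
  assumes P: "P \<in> pointed_reps g"
  shows "\<exists>C \<in> carrier_mat (dim_vec P) 9. P = mat_act C V_mono"
proof -
  have "P $ i \<in> range mono_comb" if i: "i < dim_vec P" for i
  proof -
    have "eval2 (P $ i) (0, 0) = eval_vec P (0, 0) $ i" using i by (simp add: eval_vec_def)
    also have "\<dots> = 0" using P i by (simp add: pointed_reps_def pointed_def)
    finally show ?thesis
      using P i unfolding W_space_eq_range_mono_comb[symmetric]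
      by (simp add: W_space_def pointed_reps_def vec_degree_le_iff)
  qed
  then have "\<forall>i. \<exists>c. i < dim_vec P \<longrightarrow> P $ i = mono_comb c" by auto
  then obtain c where c: "\<And>i. i < dim_vec P \<Longrightarrow> P $ i = mono_comb (c i)" by metis
  define C where "C = mat (dim_vec P) 9 (\<lambda>(i, k). c i k)"
  have C: "C \<in> carrier_mat (dim_vec P) 9" by (simp add: C_def)
  have "P = mat_act C V_mono"
  proof (rule eq_vecI)
    fix i assume "i < dim_vec (mat_act C V_mono)"
    then have i: "i < dim_vec P" using C by simp
    show "P $ i = mat_act C V_mono $ i"
      unfolding mat_act_V_index[OF C i] c[OF i] mono_comb_eq_iff using i by (simp add: C_def)
  qed (use C in simp)
  then show ?thesis using C by blast
qed

lemma vec_degree_mat_act_V: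
  assumes C: "C \<in> carrier_mat m 9"
  shows "vec_degree (mat_act C V_mono) = 3 \<longleftrightarrow> (\<exists>i<m. \<exists>k\<in>{5..<9}. C $$ (i, k) \<noteq> 0)"
proof -
  have le: "vec_degree (mat_act C V_mono) \<le> 3"
    using C by (auto simp: vec_degree_le_iff mat_act_V_index[OF C] total_degree_mono_comb_le)
  have "vec_degree (mat_act C V_mono) \<le> 2 \<longleftrightarrow> (\<forall>i<m. \<forall>k\<in>{5..<9}. C $$ (i, k) = 0)"
    using C by (auto simp: vec_degree_le_iff mat_act_V_index[OF C] total_degree_mono_comb_cubic)
  moreover have "vec_degree (mat_act C V_mono) = 3 \<longleftrightarrow> \<not> vec_degree (mat_act C V_mono) \<le> 2"
    using le by linarith
  ultimately show ?thesis by blast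
qed

section \<open>Stable equivalence and Gram matrices\<close>

definition pad_rows :: "nat \<Rightarrow> complex mat \<Rightarrow> complex mat" where
  "pad_rows k A = mat (dim_row A + k) (dim_col A) (\<lambda>(i, j). if i < dim_row A then A $$ (i, j) else 0)"

lemma pad_rows_carrier: "A \<in> carrier_mat m n \<Longrightarrow> pad_rows k A \<in> carrier_mat (m + k) n"
  by (auto simp: pad_rows_def)

lemma gram_pad_rows:
  assumes A: "A \<in> carrier_mat m n"
  shows "mat_adjoint (pad_rows k A) * pad_rows k A = mat_adjoint A * A"
proof (rule eq_matI)
  note P = pad_rows_carrier[OF A, of k]
  fix i j assume "i < dim_row (mat_adjoint A * A)" "j < dim_col (mat_adjoint A * A)"
  then have ij: "i < n" "j < n" using A by auto
  have "(mat_adjoint (pad_rows k A) * pad_rows k A) $$ (i, j)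
      = (\<Sum>l<m + k. mat_adjoint (pad_rows k A) $$ (i, l) * pad_rows k A $$ (l, j))"
    by (rule mult_mat_sum[OF mat_adjoint_carrier[OF P] P ij])
  also have "\<dots> = (\<Sum>l<m. mat_adjoint (pad_rows k A) $$ (i, l) * pad_rows k A $$ (l, j))"
    using A ij P by (intro sum.mono_neutral_right) (auto simp: pad_rows_def)
  also have "\<dots> = (\<Sum>l<m. mat_adjoint A $$ (i, l) * A $$ (l, j))"
    using A ij P by (intro sum.cong) (auto simp: pad_rows_def)
  also have "\<dots> = (mat_adjoint A * A) $$ (i, j)"
    using mult_mat_sum[OF mat_adjoint_carrier[OF A] A ij] by simp
  finally show "(mat_adjoint (pad_rows k A) * pad_rows k A) $$ (i, j) = (mat_adjoint A * A) $$ (i, j)" .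
qed (use A in \<open>auto simp: pad_rows_def\<close>)

lemma mat_act_pad_rows:
  assumes A: "A \<in> carrier_mat m 9"
  shows "mat_act A V_mono @\<^sub>v 0\<^sub>v k = mat_act (pad_rows k A) V_mono"
proof (rule eq_vecI)
  note P = pad_rows_carrier[OF A, of k]
  fix i assume "i < dim_vec (mat_act (pad_rows k A) V_mono)"
  then have i: "i < m + k" using P by simp
  show "(mat_act A V_mono @\<^sub>v 0\<^sub>v k) $ i = mat_act (pad_rows k A) V_mono $ i"
  proof (cases "i < m")
    case True
    have "mono_comb (\<lambda>k. A $$ (i, k)) = mono_comb (\<lambda>l. pad_rows k A $$ (i, l))"
      unfolding mono_comb_eq_iff using A True by (simp add: pad_rows_def)
    then show ?thesis
      using A True by (simp add: mat_act_V_index[OF P i] mat_act_V_index[OF A])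
  next
    case False
    have "mono_comb (\<lambda>l. pad_rows k A $$ (i, l)) = mono_comb (\<lambda>_. 0)"
      unfolding mono_comb_eq_iff using A False i by (simp add: pad_rows_def)
    then show ?thesis
      using A False i by (simp add: mat_act_V_index[OF P i] mono_comb_0)
  qed
qed (use A in \<open>simp add: pad_rows_def\<close>)

text \<open>
  Adjoining zero components to \<open>A V\<close> means adjoining zero rows to \<open>A\<close>, which does not affect the Gram
  matrix. Conversely, \<open>n\<close> additional rows for \<open>A\<close> and \<open>m\<close> for \<open>B\<close> make both matrices \<open>(m + n) \<times> 9\<close>, and
  then equal Gram matrices provide the unitary factor.
\<close>

lemma stably_equiv_iff_gram:
  assumes A: "A \<in> carrier_mat m 9" and B: "B \<in> carrier_mat n 9"
  shows "stably_equiv (mat_act A V_mono) (mat_act B V_mono) \<longleftrightarrow> mat_adjoint A * A = mat_adjoint B * B"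
proof
  assume "stably_equiv (mat_act A V_mono) (mat_act B V_mono)"
  then obtain k l U where kl: "m + k = n + l" and U: "unitary (m + k) U"
    and eq: "mat_act B V_mono @\<^sub>v 0\<^sub>v l = mat_act U (mat_act A V_mono @\<^sub>v 0\<^sub>v k)"
    using A B by (auto simp: stably_equiv_def)
  note PA = pad_rows_carrier[OF A, of k] and PB = pad_rows_carrier[OF B, of l] and U' = unitary_carrier[OF U]
  have "mat_act (pad_rows l B) V_mono = mat_act (U * pad_rows k A) V_mono"
    using eq unfolding mat_act_pad_rows[OF A] mat_act_pad_rows[OF B] mat_act_mult[OF U' PA] .
  then have "pad_rows l B = U * pad_rows k A"
    by (rule mat_act_V_inj[OF PB[folded kl] mult_carrier_mat[OF U' PA]])
  then show "mat_adjoint A * A = mat_adjoint B * B"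
    using unitary_gram[OF U PA] gram_pad_rows[OF A] gram_pad_rows[OF B, of l] by simp
next
  assume eq: "mat_adjoint A * A = mat_adjoint B * B"
  note PA = pad_rows_carrier[OF A, of n] and PB = pad_rows_carrier[OF B, of m, unfolded add.commute[of n m]]
  obtain U where U: "unitary (m + n) U" and UA: "U * pad_rows n A = pad_rows m B"
    using unitary_freedom[OF PA PB] eq by (auto simp: gram_pad_rows[OF A] gram_pad_rows[OF B])
  have "mat_act B V_mono @\<^sub>v 0\<^sub>v m = mat_act U (mat_act A V_mono @\<^sub>v 0\<^sub>v n)"
    unfolding mat_act_pad_rows[OF A] mat_act_pad_rows[OF B] mat_act_mult[OF unitary_carrier[OF U] PA] UA ..
  then show "stably_equiv (mat_act A V_mono) (mat_act B V_mono)"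
    using A B U unfolding stably_equiv_def
    by (intro exI[of _ n] exI[of _ m] exI[of _ U]) (simp add: add.commute)
qed

text \<open>
  In particular, the class depends on \<open>C\<close> only through \<open>C\<^sup>* C\<close>, which makes it the class of the
  numerator built from the root of \<open>C\<^sup>* C\<close>.
\<close>

lemma stable_class_mat_act:
  assumes C: "C \<in> carrier_mat m 9" and g: "eval2 g (0, 0) = 1" and H: "mat_adjoint C * C \<in> gram_set g"
  shows "stable_class g (mat_act C V_mono) =
    {mat_act B V_mono | n B. B \<in> carrier_mat n 9 \<and> mat_adjoint B * B = mat_adjoint C * C}"
proof (intro equalityI subsetI)
  fix Q assume "Q \<in> stable_class g (mat_act C V_mono)"
  then have Q: "Q \<in> pointed_reps g" and eq: "stably_equiv (mat_act C V_mono) Q"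
    by (auto simp: stable_class_def stable_rel_def)
  obtain B where B: "B \<in> carrier_mat (dim_vec Q) 9" "Q = mat_act B V_mono"
    using pointed_reps_factor[OF Q] by blast
  then show "Q \<in> {mat_act B V_mono | n B. B \<in> carrier_mat n 9 \<and> mat_adjoint B * B = mat_adjoint C * C}"
    using stably_equiv_iff_gram[OF C B(1)] eq by auto
next
  fix Q assume "Q \<in> {mat_act B V_mono | n B. B \<in> carrier_mat n 9 \<and> mat_adjoint B * B = mat_adjoint C * C}"
  then obtain n B where B: "B \<in> carrier_mat n 9" "Q = mat_act B V_mono"
    and BC: "mat_adjoint B * B = mat_adjoint C * C" by blast
  then show "Q \<in> stable_class g (mat_act C V_mono)"
    using mat_act_V_in_pointed_reps[OF C g] mat_act_V_in_pointed_reps[OF B(1) g]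
      stably_equiv_iff_gram[OF C B(1)] H
    by (simp add: stable_class_def stable_rel_def)
qed

lemma P_num_factor:
  assumes "H \<in> gram_set g"
  shows "psd_sqrt 9 H \<in> carrier_mat 9 9" "mat_adjoint (psd_sqrt 9 H) * psd_sqrt 9 H = H"
    "P_num H = mat_act (psd_sqrt 9 H) V_mono"
  using assms psd_sqrt_gram[of 9 H] by (auto simp: gram_set_def P_num_def)

lemma stable_class_P_num:
  assumes g: "eval2 g (0, 0) = 1" and H: "H \<in> gram_set g"
  shows "stable_class g (P_num H) = {mat_act B V_mono | n B. B \<in> carrier_mat n 9 \<and> mat_adjoint B * B = H}"
  unfolding P_num_factor(3)[OF H]
  using stable_class_mat_act[OF P_num_factor(1)[OF H] g] H by (simp add: P_num_factor(2)[OF H])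

lemma stable_classes_bij:
  assumes g: "eval2 g (0, 0) = 1"
  shows "bij_betw (\<lambda>H. stable_class g (P_num H)) (gram_set g) (pointed_reps g // stable_rel g)"
  unfolding bij_betw_def
proof
  show "inj_on (\<lambda>H. stable_class g (P_num H)) (gram_set g)"
  proof (rule inj_onI)
    fix H K assume H: "H \<in> gram_set g" and K: "K \<in> gram_set g"
      and eq: "stable_class g (P_num H) = stable_class g (P_num K)"
    have "P_num H \<in> stable_class g (P_num H)"
      unfolding stable_class_P_num[OF g H] using P_num_factor[OF H] by blast
    then obtain n B where B: "B \<in> carrier_mat n 9" "P_num H = mat_act B V_mono" "mat_adjoint B * B = K"
      unfolding eq stable_class_P_num[OF g K] by blast
    have "n = 9"
      using arg_cong[OF B(2), of dim_vec] B(1) P_num_factor(1)[OF H] by (simp add: P_num_factor(3)[OF H])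
    then have "psd_sqrt 9 H = B"
      using mat_act_V_inj[OF P_num_factor(1)[OF H], of B] B P_num_factor(3)[OF H] by simp
    then show "H = K" using P_num_factor(2)[OF H] B(3) by simp
  qed
  show "(\<lambda>H. stable_class g (P_num H)) ` gram_set g = pointed_reps g // stable_rel g"
  proof (intro equalityI subsetI)
    fix X assume "X \<in> (\<lambda>H. stable_class g (P_num H)) ` gram_set g"
    then obtain H where H: "H \<in> gram_set g" and X: "X = stable_class g (P_num H)" by blast
    have "P_num H \<in> pointed_reps g"
      using mat_act_V_in_pointed_reps[OF P_num_factor(1)[OF H] g] H
      by (simp add: P_num_factor(2,3)[OF H])
    then show "X \<in> pointed_reps g // stable_rel g"
      unfolding X stable_class_def by (rule quotientI)
  next
    fix X assume "X \<in> pointed_reps g // stable_rel g"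
    then obtain P where P: "P \<in> pointed_reps g" and X: "X = stable_class g P"
      by (auto simp: quotient_def stable_class_def)
    obtain C where C: "C \<in> carrier_mat (dim_vec P) 9" and PC: "P = mat_act C V_mono"
      using pointed_reps_factor[OF P] by blast
    have H: "mat_adjoint C * C \<in> gram_set g" using mat_act_V_in_pointed_reps[OF C g] P PC by simp
    have "X = stable_class g (P_num (mat_adjoint C * C))"
      unfolding X stable_class_P_num[OF g H] unfolding PC stable_class_mat_act[OF C g H] ..
    then show "X \<in> (\<lambda>H. stable_class g (P_num H)) ` gram_set g" using H by blast
  qed
qed

text \<open>
  A factor \<open>B\<close> of \<open>H = B\<^sup>* B\<close> has at least \<open>rank H\<close> rows, and a minimal factorization attains the bound.
\<close>

lemma least_dimension_of_class:
  assumes g: "eval2 g (0, 0) = 1" and H: "H \<in> gram_set g"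
  shows "(LEAST N. \<exists>P \<in> stable_class g (P_num H). dim_vec P = N) = vec_space.rank 9 H"
proof (rule Least_equality)
  have "psd 9 H" using H by (simp add: gram_set_def)
  then obtain C where C: "C \<in> carrier_mat (vec_space.rank 9 H) 9" "mat_adjoint C * C = H"
    using psd_minimal_factorization by blast
  have "mat_act C V_mono \<in> stable_class g (P_num H)"
    unfolding stable_class_P_num[OF g H] using C by blast
  then show "\<exists>P \<in> stable_class g (P_num H). dim_vec P = vec_space.rank 9 H"
    using C by (intro bexI[of _ "mat_act C V_mono"]) simp_all
next
  fix N assume "\<exists>P \<in> stable_class g (P_num H). dim_vec P = N"
  then obtain B where "B \<in> carrier_mat N 9" "mat_adjoint B * B = H"
    unfolding stable_class_P_num[OF g H] by auto
  then show "vec_space.rank 9 H \<le> N" using rank_gram_le by blast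
qed

section \<open>The span of the components\<close>

lemma cspan_family: "cspan (f ` {..<m :: nat}) = {\<Sum>i<m. const2 (c i) * f i | c. True}" (is "_ = ?T")
proof
  have "bpoly_vs.subspace ?T"
  proof (rule bpoly_vs.subspaceI)
    show "0 \<in> ?T" by (auto intro!: exI[of _ "\<lambda>_. 0"])
  next
    fix p q assume "p \<in> ?T" "q \<in> ?T"
    then obtain c d where "p = (\<Sum>i<m. const2 (c i) * f i)" "q = (\<Sum>i<m. const2 (d i) * f i)" by auto
    then have "p + q = (\<Sum>i<m. const2 (c i + d i) * f i)"
      by (simp add: const2_hom(1) distrib_right sum.distrib)
    then show "p + q \<in> ?T" by (auto intro!: exI[of _ "\<lambda>i. c i + d i"])
  next
    fix a p assume "p \<in> ?T"
    then obtain c where "p = (\<Sum>i<m. const2 (c i) * f i)" by auto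
    then have "const2 a * p = (\<Sum>i<m. const2 (a * c i) * f i)"
      by (simp only: const2_hom(2) sum_distrib_left mult.assoc)
    then show "const2 a * p \<in> ?T" by (auto intro!: exI[of _ "\<lambda>i. a * c i"])
  qed
  moreover have "f ` {..<m} \<subseteq> ?T"
  proof
    fix p assume "p \<in> f ` {..<m}"
    then obtain j where j: "j < m" "p = f j" by auto
    then have "p = (\<Sum>i<m. if i = j then f j else 0)" by simp
    also have "\<dots> = (\<Sum>i<m. const2 (if i = j then 1 else 0) * f i)"
      by (intro sum.cong) (auto simp: const2_hom(3))
    finally show "p \<in> ?T" by (auto intro!: exI[of _ "\<lambda>i. if i = j then 1 else 0"])
  qed
  ultimately show "cspan (f ` {..<m}) \<subseteq> ?T" by (rule bpoly_vs.span_minimal[rotated])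
  show "?T \<subseteq> cspan (f ` {..<m})"
    by (auto intro!: bpoly_vs.span_sum bpoly_vs.span_scale intro: bpoly_vs.span_base)
qed

lemma E_space_eq_mono_comb:
  assumes H: "H \<in> carrier_mat 9 9"
  shows "E_space H = {mono_comb (\<lambda>k. cnj (v $ k)) | v. v \<in> range_mat H}"
proof -
  have "scalar_prod (map_vec const2 (conjugate v)) V_mono = mono_comb (\<lambda>k. cnj (v $ k))" if "v \<in> range_mat H" for v
  proof -
    have "v \<in> carrier_vec 9" using that mult_mat_vec_carrier[OF H] unfolding range_mat_alt[OF H] by auto
    then show ?thesis by (auto simp: scalar_prod_def mono_comb_def lessThan_atLeast0 intro!: sum.cong)
  qed
  then show ?thesis unfolding E_space_def by (auto; metis)
qed

text \<open>
  The range of \<open>C\<^sup>* C\<close> consists of the vectors \<open>C\<^sup>* x\<close>, and \<open>(C\<^sup>* x)\<^sup>* V = x\<^sup>* (C V)\<close> is the general linear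
  combination of the components of \<open>C V\<close>.
\<close>

lemma E_space_gram:
  assumes C: "C \<in> carrier_mat m 9"
  shows "E_space (mat_adjoint C * C) = cspan (set\<^sub>v (mat_act C V_mono))"
proof -
  note aC = mat_adjoint_carrier[OF C]
  have comb: "mono_comb (\<lambda>k. cnj ((mat_adjoint C *\<^sub>v x) $ k)) = (\<Sum>i<m. const2 (cnj (x $ i)) * mat_act C V_mono $ i)"
    if x: "x \<in> carrier_vec m" for x
  proof -
    have "mono_comb (\<lambda>k. cnj ((mat_adjoint C *\<^sub>v x) $ k)) = mono_comb (\<lambda>k. \<Sum>i<m. cnj (x $ i) * C $$ (i, k))"
      unfolding mono_comb_eq_iff
      using C by (auto simp: mult_mat_vec_sum[OF aC x] mult.commute simp del: index_mult_mat_vec intro!: sum.cong)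
    also have "\<dots> = (\<Sum>i<m. const2 (cnj (x $ i)) * mat_act C V_mono $ i)"
      by (simp add: mono_comb_sum mono_comb_smult mat_act_V_index[OF C])
    finally show ?thesis .
  qed
  have "E_space (mat_adjoint C * C) = {mono_comb (\<lambda>k. cnj (v $ k)) | v. v \<in> range_mat (mat_adjoint C)}"
    using E_space_eq_mono_comb[OF mult_carrier_mat[OF aC C]] unfolding range_gram[OF C] .
  also have "\<dots> = {\<Sum>i<m. const2 (cnj (x $ i)) * mat_act C V_mono $ i | x. x \<in> carrier_vec m}"
    unfolding range_mat_alt[OF aC] by (auto simp: comb; metis comb)
  also have "\<dots> = {\<Sum>i<m. const2 (c i) * mat_act C V_mono $ i | c. True}"
  proof (intro equalityI subsetI)
    fix p assume "p \<in> {\<Sum>i<m. const2 (c i) * mat_act C V_mono $ i | c. True}"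
    then obtain c where p: "p = (\<Sum>i<m. const2 (c i) * mat_act C V_mono $ i)" by auto
    show "p \<in> {\<Sum>i<m. const2 (cnj (x $ i)) * mat_act C V_mono $ i | x. x \<in> carrier_vec m}"
      unfolding p by (intro CollectI exI[of _ "vec m (\<lambda>i. cnj (c i))"]) auto
  qed auto
  also have "\<dots> = cspan (set\<^sub>v (mat_act C V_mono))"
    using C unfolding vec_set_def cspan_family[symmetric] by simp
  finally show ?thesis .
qed

lemma reduced_iff_span:
  "reduced P g \<longleftrightarrow> \<not> (\<exists>d. nonconstant d \<and> d dvd g \<and> (\<forall>p \<in> cspan (set\<^sub>v P). d dvd p))"
proof -
  have "(\<forall>p \<in> set\<^sub>v P. d dvd p) \<longleftrightarrow> (\<forall>p \<in> cspan (set\<^sub>v P). d dvd p)" for d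
  proof
    assume d: "\<forall>p \<in> set\<^sub>v P. d dvd p"
    show "\<forall>p \<in> cspan (set\<^sub>v P). d dvd p"
      using d unfolding vec_set_def cspan_family by (auto intro!: dvd_sum dvd_mult)
  qed (auto intro: bpoly_vs.span_base)
  then show ?thesis unfolding reduced_def by simp
qed

text \<open>
  The cubic block is the Gram matrix of the last four columns of \<open>H\<^sup>1\<^sup>/\<^sup>2\<close>, which hold the coefficients
  of the cubic monomials.
\<close>

lemma degree_three_iff_cubic_block:
  assumes H: "H \<in> gram_set g"
  shows "vec_degree (P_num H) = 3 \<longleftrightarrow> cubic_block H \<noteq> 0\<^sub>m 4 4"
proof -
  define R where "R = psd_sqrt 9 H"
  have R: "R \<in> carrier_mat 9 9" and RR: "mat_adjoint R * R = H" and P: "P_num H = mat_act R V_mono"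
    using P_num_factor[OF H] by (auto simp: R_def)
  have entry: "H $$ (i, j) = (\<Sum>l<9. cnj (R $$ (l, i)) * R $$ (l, j))" if "i < 9" "j < 9" for i j
    unfolding RR[symmetric] mult_mat_sum[OF mat_adjoint_carrier[OF R] R that]
    using R that by (intro sum.cong) auto
  have "(\<forall>i<9. \<forall>k\<in>{5..<9}. R $$ (i, k) = 0) \<longleftrightarrow> cubic_block H = 0\<^sub>m 4 4"
  proof
    assume "\<forall>i<9. \<forall>k\<in>{5..<9}. R $$ (i, k) = 0"
    then show "cubic_block H = 0\<^sub>m 4 4"
      by (intro eq_matI) (auto simp: cubic_block_def entry)
  next
    assume 0: "cubic_block H = 0\<^sub>m 4 4"
    show "\<forall>i<9. \<forall>k\<in>{5..<9}. R $$ (i, k) = 0"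
    proof (intro allI impI ballI)
      fix i k :: nat assume i: "i < 9" and k: "k \<in> {5..<9}"
      then have k': "k - 5 < 4" "k = k - 5 + 5" "k < 9" by auto
      have "H $$ (k, k) = cubic_block H $$ (k - 5, k - 5)" using k' by (simp add: cubic_block_def)
      then have "H $$ (k, k) = 0" using 0 k' by simp
      then have "complex_of_real (sq_norm2 (col R k)) = 0"
        using gram_index[OF R k'(3) k'(3)] by (simp add: RR cscalar_prod_self)
      then have "col R k = 0\<^sub>v 9" using sq_norm2_eq_0_iff[of "col R k" 9] R by (simp add: carrier_vecI)
      then have "col R k $ i = 0" using i by simp
      then show "R $$ (i, k) = 0" using R i k' by simp
    qed
  qed
  then show ?thesis unfolding P vec_degree_mat_act_V[OF R] by blast
qed

lemma pos_def_diagonal_nonzero: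
  assumes H: "pos_def n H" and i: "i < n"
  shows "H $$ (i, i) \<noteq> 0"
proof -
  define e where "e = (unit_vec n i :: complex vec)"
  have e: "e \<in> carrier_vec n" "e \<noteq> 0\<^sub>v n" using i by (simp_all add: e_def)
  have H': "H \<in> carrier_mat n n" using H by (simp add: pos_def_def)
  have ce: "conjugate e = e" by (rule eq_vecI) (auto simp: e_def unit_vec_def)
  have "(H *\<^sub>v e) \<bullet>c e = (H *\<^sub>v e) $ i"
    unfolding ce using scalar_prod_right_unit[OF i, of "H *\<^sub>v e"] by (simp add: e_def)
  also have "\<dots> = row H i \<bullet> e" using H' i by simp
  also have "\<dots> = H $$ (i, i)"
    using scalar_prod_right_unit[OF i, of "row H i"] H' i by (simp add: e_def)
  finally show ?thesis using H e unfolding pos_def_def by fastforce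
qed

text \<open>
  Both spaces are images under the injective map \<open>v \<mapsto> v\<^sup>* V\<close>: of the range of \<open>H\<close>, and of the
  whole coordinate space.
\<close>

lemma E_space_eq_W_space_iff:
  assumes H: "H \<in> carrier_mat 9 9"
  shows "E_space H = W_space \<longleftrightarrow> vec_space.rank 9 H = 9"
proof -
  have sub: "range_mat H \<subseteq> carrier_vec 9"
    unfolding range_mat_alt[OF H] using mult_mat_vec_carrier[OF H] by blast
  have "E_space H = W_space \<longleftrightarrow> carrier_vec 9 \<subseteq> range_mat H"
  proof
    assume eq: "E_space H = W_space"
    show "carrier_vec 9 \<subseteq> range_mat H"
    proof
      fix v :: "complex vec" assume v: "v \<in> carrier_vec 9"
      have "mono_comb (\<lambda>k. cnj (v $ k)) \<in> E_space H" unfolding eq W_space_eq_range_mono_comb by simp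
      then obtain w where w: "w \<in> range_mat H" "mono_comb (\<lambda>k. cnj (v $ k)) = mono_comb (\<lambda>k. cnj (w $ k))"
        unfolding E_space_eq_mono_comb[OF H] by blast
      have "w \<in> carrier_vec 9" using w sub by blast
      then have "v = w" using w(2) v unfolding mono_comb_eq_iff by (intro eq_vecI) auto
      then show "v \<in> range_mat H" using w by simp
    qed
  next
    assume full: "carrier_vec 9 \<subseteq> range_mat H"
    show "E_space H = W_space"
      unfolding E_space_eq_mono_comb[OF H] W_space_eq_range_mono_comb
    proof (intro equalityI subsetI)
      fix p assume "p \<in> range mono_comb"
      then obtain c where c: "p = mono_comb c" by blast
      have "p = mono_comb (\<lambda>k. cnj (vec 9 (\<lambda>k. cnj (c k)) $ k))" unfolding c mono_comb_eq_iff by simp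
      moreover have "vec 9 (\<lambda>k. cnj (c k)) \<in> range_mat H" using full by (auto simp del: subset_UNIV)
      ultimately show "p \<in> {mono_comb (\<lambda>k. cnj (v $ k)) | v. v \<in> range_mat H}" by blast
    qed auto
  qed
  then show ?thesis using sub full_rank_iff_range[OF H] by auto
qed

text \<open>
  A divisor of \<open>z\<^sub>1\<close> does not involve \<open>z\<^sub>2\<close>. If it also divides \<open>z\<^sub>2\<close>, it divides the coefficient 1 of \<open>z\<^sub>2\<close>.
\<close>

lemma common_divisor_of_variables_constant:
  assumes "d dvd Z1" "d dvd Z2"
  shows "\<not> nonconstant d"
proof -
  obtain e where e: "Z1 = d * e" using assms(1) by blast
  have nz: "d \<noteq> 0" "e \<noteq> 0" using e by (auto simp: Z1_def)
  have "degree d + degree e = 0" using degree_mult_eq[OF nz] e by (simp add: Z1_def)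
  then obtain q where q: "d = [:q:]" by (auto elim: degree_eq_zeroE)
  have "q dvd coeff Z2 1" using assms(2) unfolding q const_poly_dvd_iff by blast
  then have "q dvd 1" by (simp add: Z2_def)
  then have "degree q = 0" using is_unit_iff_degree by force
  then obtain c where "q = [:c:]" by (auto elim: degree_eq_zeroE)
  then show ?thesis using q by (auto simp: nonconstant_def const2_def)
qed

lemma variables_in_W_space: "Z1 \<in> W_space" "Z2 \<in> W_space"
proof -
  have "V_mono $ j \<in> W_space" if "j < 9" for j
  proof -
    have "(\<Sum>k<9. const2 (if k = j then 1 else 0) * V_mono $ k) = (\<Sum>k<9. if k = j then V_mono $ k else 0)"
      by (intro sum.cong) (auto simp: const2_hom(3))
    then have "V_mono $ j = mono_comb (\<lambda>k. if k = j then 1 else 0)"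
      unfolding mono_comb_def using that by simp
    then show ?thesis unfolding W_space_eq_range_mono_comb by blast
  qed
  from this[of 0] this[of 1] show "Z1 \<in> W_space" "Z2 \<in> W_space" by (simp_all add: V_mono_def)
qed

section \<open>The map into the ball\<close>

lemma holomorphic2_on_const: "holomorphic2_on (\<lambda>_. c) S"
  unfolding holomorphic2_on_def by (auto intro!: exI[of _ "\<lambda>_. 0"] derivative_eq_intros)

lemma holomorphic2_on_fst: "holomorphic2_on fst S"
  unfolding holomorphic2_on_def by (auto intro!: exI[of _ fst] derivative_eq_intros)

lemma holomorphic2_on_snd: "holomorphic2_on snd S"
  unfolding holomorphic2_on_def by (auto intro!: exI[of _ snd] derivative_eq_intros)

lemma holomorphic2_on_add:
  assumes "holomorphic2_on f S" "holomorphic2_on h S"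
  shows "holomorphic2_on (\<lambda>z. f z + h z) S"
  unfolding holomorphic2_on_def
proof
  fix z assume z: "z \<in> S"
  obtain D where D: "(f has_derivative D) (at z)" "\<And>c a b. D (c * a, c * b) = c * D (a, b)"
    using assms(1) z unfolding holomorphic2_on_def by blast
  obtain E where E: "(h has_derivative E) (at z)" "\<And>c a b. E (c * a, c * b) = c * E (a, b)"
    using assms(2) z unfolding holomorphic2_on_def by blast
  show "\<exists>D. ((\<lambda>z. f z + h z) has_derivative D) (at z) \<and> (\<forall>c a b. D (c * a, c * b) = c * D (a, b))"
    by (rule exI[of _ "\<lambda>x. D x + E x"]) (simp add: has_derivative_add D E distrib_left)
qed

lemma holomorphic2_on_mult:
  assumes "holomorphic2_on f S" "holomorphic2_on h S"
  shows "holomorphic2_on (\<lambda>z. f z * h z) S"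
  unfolding holomorphic2_on_def
proof
  fix z assume z: "z \<in> S"
  obtain D where D: "(f has_derivative D) (at z)" "\<And>c a b. D (c * a, c * b) = c * D (a, b)"
    using assms(1) z unfolding holomorphic2_on_def by blast
  obtain E where E: "(h has_derivative E) (at z)" "\<And>c a b. E (c * a, c * b) = c * E (a, b)"
    using assms(2) z unfolding holomorphic2_on_def by blast
  show "\<exists>D. ((\<lambda>z. f z * h z) has_derivative D) (at z) \<and> (\<forall>c a b. D (c * a, c * b) = c * D (a, b))"
    by (rule exI[of _ "\<lambda>x. f z * E x + D x * h z"], intro conjI has_derivative_mult D(1) E(1))
      (simp add: D(2) E(2) algebra_simps)
qed

lemma holomorphic2_on_divide:
  assumes "holomorphic2_on f S" "holomorphic2_on h S" "\<And>z. z \<in> S \<Longrightarrow> h z \<noteq> 0"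
  shows "holomorphic2_on (\<lambda>z. f z / h z) S"
  unfolding holomorphic2_on_def
proof
  fix z assume z: "z \<in> S"
  obtain D where D: "(f has_derivative D) (at z)" "\<And>c a b. D (c * a, c * b) = c * D (a, b)"
    using assms(1) z unfolding holomorphic2_on_def by blast
  obtain E where E: "(h has_derivative E) (at z)" "\<And>c a b. E (c * a, c * b) = c * E (a, b)"
    using assms(2) z unfolding holomorphic2_on_def by blast
  show "\<exists>D. ((\<lambda>z. f z / h z) has_derivative D) (at z) \<and> (\<forall>c a b. D (c * a, c * b) = c * D (a, b))"
    by (rule exI[of _ "\<lambda>x. (D x * h z - f z * E x) / (h z * h z)"], intro conjI has_derivative_divide' D(1) E(1) assms(3) z)
      (simp add: D(2) E(2) algebra_simps)
qed

lemma eval2_pCons: "eval2 (pCons q p) z = poly q (fst z) + snd z * eval2 p z"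
  by (simp add: eval2_def)

lemma holomorphic2_on_eval2: "holomorphic2_on (eval2 p) S"
proof (induction p)
  case 0
  have "eval2 0 = (\<lambda>_. 0)" by (rule ext) simp
  then show ?case using holomorphic2_on_const[of 0] by simp
next
  case (pCons q p)
  have "holomorphic2_on (\<lambda>z. poly r (fst z)) S" for r
    by (induction r) (simp_all add: holomorphic2_on_const holomorphic2_on_fst holomorphic2_on_add holomorphic2_on_mult)
  then have "holomorphic2_on (\<lambda>z. poly q (fst z) + snd z * eval2 p z) S"
    by (intro holomorphic2_on_add holomorphic2_on_mult holomorphic2_on_snd pCons.IH)
  moreover have "eval2 (pCons q p) = (\<lambda>z. poly q (fst z) + snd z * eval2 p z)"
    by (rule ext) (rule eval2_pCons)
  ultimately show ?case by simp
qed

lemma eval2_line_holomorphic: "(\<lambda>l. eval2 p (l * a, l * b)) holomorphic_on S"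
proof (induction p)
  case (pCons q p)
  have "(\<lambda>l. poly r (l * a)) holomorphic_on S" for r
    by (induction r) (auto intro!: holomorphic_intros)
  then show ?case using pCons.IH by (auto simp: eval2_pCons intro!: holomorphic_intros)
qed simp

lemma sq_norm2_inner_bound:
  assumes w: "w \<in> carrier_vec n" and x: "x \<in> carrier_vec n"
  shows "cmod (x \<bullet>c w) \<le> sqrt (sq_norm2 x) * sqrt (sq_norm2 w)"
proof -
  have "cmod (x \<bullet>c w) \<le> (\<Sum>i<n. cmod (x $ i) * cmod (w $ i))"
    unfolding cscalar_prod_sum[OF x w] by (rule order_trans[OF norm_sum]) (simp add: norm_mult)
  also have "\<dots> \<le> sqrt ((\<Sum>i<n. cmod (x $ i) * cmod (w $ i))\<^sup>2)" by simp
  also have "\<dots> \<le> sqrt ((\<Sum>i<n. (cmod (x $ i))\<^sup>2) * (\<Sum>i<n. (cmod (w $ i))\<^sup>2))"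
    by (rule real_sqrt_le_mono) (rule Cauchy_Schwarz_ineq_sum)
  finally show ?thesis using w x by (simp add: sq_norm2_def real_sqrt_mult)
qed

text \<open>
  Let \<open>w = F(z)\<close> and \<open>N = \<parallel>w\<parallel>\<close>. On the complex line through 0 and \<open>z\<close>, parametrized by the unit disc,
  \<open>f(l) = w\<^sup>* F(l u)\<close> with \<open>u = z / \<parallel>z\<parallel>\<close> vanishes at 0 and is bounded by \<open>N\<close> on the circle. The Schwarz
  lemma yields \<open>N\<^sup>2 = f(\<parallel>z\<parallel>) \<le> N \<parallel>z\<parallel>\<close>, whence \<open>N \<le> \<parallel>z\<parallel> < 1\<close>.
\<close>

lemma quotient_map_in_unit_ball:
  assumes sph: "sphere_identity P g" and P0: "eval_vec P (0, 0) = 0\<^sub>v (dim_vec P)"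
    and g: "\<And>z. norm z \<le> 1 \<Longrightarrow> eval2 g z \<noteq> 0" and z: "norm z < 1"
  shows "sq_norm2 (quotient_map P g z) < 1"
proof (cases "z = 0")
  case True
  have "eval2 (P $ i) (0, 0) = 0" if "i < dim_vec P" for i
    using arg_cong[OF P0, of "\<lambda>v. v $ i"] that by (simp add: eval_vec_def)
  then show ?thesis using True by (simp add: sq_norm2_def quotient_map_def zero_prod_def)
next
  case False
  define n where "n = dim_vec P"
  define r where "r = norm z"
  define a b where "a = fst z / of_real r" and "b = snd z / of_real r"
  define F where "F = (\<lambda>l. quotient_map P g (l * a, l * b))"
  define w where "w = quotient_map P g z"
  define f where "f = (\<lambda>l. F l \<bullet>c w)"
  define N where "N = sqrt (sq_norm2 w)"
  have r: "0 < r" "r < 1" using z False by (auto simp: r_def)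
  have F: "F l \<in> carrier_vec n" for l by (rule carrier_vecI) (simp add: F_def quotient_map_def n_def)
  have w: "w \<in> carrier_vec n" by (rule carrier_vecI) (simp add: w_def quotient_map_def n_def)
  have "(cmod a)\<^sup>2 + (cmod b)\<^sup>2 = ((cmod (fst z))\<^sup>2 + (cmod (snd z))\<^sup>2) / r\<^sup>2"
    by (simp add: a_def b_def norm_divide power_divide add_divide_distrib)
  also have "(cmod (fst z))\<^sup>2 + (cmod (snd z))\<^sup>2 = r\<^sup>2" by (simp add: r_def norm_prod_def)
  also have "r\<^sup>2 / r\<^sup>2 = 1" using r by simp
  finally have ab: "(cmod a)\<^sup>2 + (cmod b)\<^sup>2 = 1" .
  have norm_line: "norm (l * a, l * b) = cmod l" for l
    using ab by (simp add: norm_Pair norm_mult power_mult_distrib flip: distrib_left)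
  have Fr: "F (of_real r) = w" using r by (simp add: F_def w_def a_def b_def)
  have F0: "F 0 = 0\<^sub>v n"
  proof (rule eq_vecI)
    fix i assume "i < dim_vec (0\<^sub>v n :: complex vec)"
    then show "F 0 $ i = 0\<^sub>v n $ i"
      using arg_cong[OF P0, of "\<lambda>v. v $ i"] by (simp add: F_def eval_vec_def quotient_map_def n_def)
  qed (simp add: F_def quotient_map_def n_def)
  have hol: "f holomorphic_on cball 0 1"
  proof -
    have "f = (\<lambda>l. \<Sum>i<n. eval2 (P $ i) (l * a, l * b) / eval2 g (l * a, l * b) * cnj (w $ i))"
      unfolding f_def by (rule ext, subst cscalar_prod_sum[OF F w]) (simp add: F_def quotient_map_def n_def)
    moreover have "(\<lambda>l. \<Sum>i<n. eval2 (P $ i) (l * a, l * b) / eval2 g (l * a, l * b) * cnj (w $ i))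
        holomorphic_on cball 0 1"
      by (intro holomorphic_on_sum holomorphic_on_mult holomorphic_on_divide eval2_line_holomorphic
          holomorphic_on_const g) (simp add: norm_line)
    ultimately show ?thesis by simp
  qed
  have circle: "cmod (f l) \<le> N" if l: "cmod l = 1" for l
  proof -
    have "(l * a, l * b) \<in> sphere (0, 0) 1" 
      unfolding mem_sphere zero_prod_def[symmetric] dist_0_norm using l norm_line by simp
    then have eq: "sq_norm2 (eval_vec P (l * a, l * b)) = (cmod (eval2 g (l * a, l * b)))\<^sup>2"
      using sph by (simp add: sphere_identity_def)
    have "sq_norm2 (F l) = sq_norm2 (eval_vec P (l * a, l * b)) / (cmod (eval2 g (l * a, l * b)))\<^sup>2"
      by (simp add: F_def quotient_map_def eval_vec_def sq_norm2_def norm_divide power_divide sum_divide_distrib)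
    then have "sq_norm2 (F l) = 1" using eq g[of "(l * a, l * b)"] norm_line l by simp
    then show ?thesis using sq_norm2_inner_bound[OF w F, of l] by (simp add: f_def N_def)
  qed
  have ball: "cmod (f l) \<le> N" if "cmod l \<le> 1" for l
    by (rule maximum_modulus_frontier[of f "cball 0 1"])
      (use that circle hol in \<open>auto intro: holomorphic_on_subset holomorphic_on_imp_continuous_on\<close>)
  have fr: "f (of_real r) = of_real (N\<^sup>2)"
    by (simp add: f_def Fr cscalar_prod_self N_def sq_norm2_def sum_nonneg)
  have "N < 1"
  proof (rule ccontr)
    assume "\<not> N < 1"
    \<comment> \<open>The Schwarz lemma asks for a strict bound on the disc; any \<open>M\<close> with \<open>N < M < N / r\<close> will do.\<close>
    define M where "M = 2 * N / (1 + r)"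
    have M: "N < M" "r * M < N" using \<open>\<not> N < 1\<close> r by (auto simp: M_def field_simps)
    then have M0: "0 < M" using \<open>\<not> N < 1\<close> by simp
    have "cmod (f (of_real r) / of_real M) \<le> cmod (of_real r)"
    proof (rule Schwarz_Lemma(1)[of "\<lambda>l. f l / of_real M"])
      show "(\<lambda>l. f l / of_real M) holomorphic_on ball 0 1"
        using hol M0 by (intro holomorphic_intros) (auto intro: holomorphic_on_subset)
      show "f 0 / of_real M = 0" using F0 w by (simp add: f_def)
      show "cmod (f l / of_real M) < 1" if "cmod l < 1" for l
        using ball[of l] that M M0 by (simp add: norm_divide)
    qed (use r in simp)
    then have "N\<^sup>2 \<le> r * M" using r M0 unfolding fr norm_divide norm_of_real by (simp add: field_simps)
    then have "N\<^sup>2 < N" using M by simp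
    then show False using \<open>\<not> N < 1\<close> by (simp add: power2_eq_square)
  qed
  then show ?thesis by (simp add: N_def w_def)
qed

lemma g_poly_eval: "eval2 (g_poly s t) z = 1 + of_real s * (fst z)\<^sup>2 + of_real t * (snd z)\<^sup>2"
  by (simp add: g_poly_def)

text \<open>
  \<open>\<bar>s z\<^sub>1\<^sup>2 + t z\<^sub>2\<^sup>2\<bar> \<le> s \<parallel>z\<parallel>\<^sup>2 < 1\<close> on the closed ball.
\<close>

lemma g_poly_nonzero:
  assumes "0 \<le> t" "t \<le> s" "s < 1" "norm z \<le> 1"
  shows "eval2 (g_poly s t) z \<noteq> 0"
proof
  assume "eval2 (g_poly s t) z = 0"
  then have "of_real s * (fst z)\<^sup>2 + of_real t * (snd z)\<^sup>2 = (- 1 :: complex)"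
    unfolding g_poly_eval by (simp add: add_eq_0_iff algebra_simps)
  then have "1 = cmod (of_real s * (fst z)\<^sup>2 + of_real t * (snd z)\<^sup>2)" by simp
  also have "\<dots> \<le> s * (cmod (fst z))\<^sup>2 + t * (cmod (snd z))\<^sup>2"
    using assms by (intro order_trans[OF norm_triangle_ineq]) (simp add: norm_mult norm_power)
  also have "\<dots> \<le> s * (cmod (fst z))\<^sup>2 + s * (cmod (snd z))\<^sup>2"
    using assms by (intro add_left_mono mult_right_mono) auto
  also have "\<dots> = s * (norm z)\<^sup>2" by (simp add: norm_prod_def distrib_left)
  also have "\<dots> \<le> s * 1" using assms by (intro mult_left_mono) (auto simp: power_le_one)
  finally show False using assms by simp
qed

lemma quotient_sphere_map:
  assumes sph: "sphere_identity P g" and g: "\<And>z. norm z \<le> 1 \<Longrightarrow> eval2 g z \<noteq> 0"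
  shows "sphere_map (quotient_map P g) P g"
  unfolding sphere_map_def
proof (intro conjI ballI allI impI)
  show "g \<noteq> 0" using g[of 0] by auto
  show "sphere_identity P g" by fact
  fix z :: "complex \<times> complex" assume "z \<in> ball (0, 0) 1"
  then have z: "norm z \<le> 1" by (simp add: zero_prod_def[symmetric])
  show "dim_vec (quotient_map P g z) = dim_vec P" by (simp add: quotient_map_def)
  show "eval2 g z \<cdot>\<^sub>v quotient_map P g z = eval_vec P z"
    using g[OF z] by (intro eq_vecI) (auto simp: quotient_map_def eval_vec_def)
next
  fix i assume i: "i < dim_vec P"
  have "(\<lambda>z. quotient_map P g z $ i) = (\<lambda>z. eval2 (P $ i) z / eval2 g z)"
    using i by (simp add: quotient_map_def)
  moreover have "holomorphic2_on (\<lambda>z. eval2 (P $ i) z / eval2 g z) (ball (0, 0) 1)"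
    by (intro holomorphic2_on_divide holomorphic2_on_eval2 g) (simp add: zero_prod_def[symmetric])
  ultimately show "holomorphic2_on (\<lambda>z. quotient_map P g z $ i) (ball (0, 0) 1)" by simp
qed

section \<open>Gram matrices and pointed representations\<close>

theorem theorem5p1:
  fixes \<sigma>1 \<sigma>2 :: real and g :: bpoly
  assumes "0 \<le> \<sigma>2" and "\<sigma>2 \<le> \<sigma>1" and "\<sigma>1 < 1"
    and "sqrt (1 - \<sigma>1\<^sup>2) + sqrt (1 - \<sigma>2\<^sup>2) > 1"
    and "g = g_poly \<sigma>1 \<sigma>2"
  shows
    "(\<forall>H \<in> gram_set g.
        pointed (P_num H) g \<and> sphere_map (F_map H g) (P_num H) g \<and>
        F_map H g ` ball (0, 0) 1 \<subseteq> unit_ball 9)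
     \<and>
     (bij_betw (\<lambda>H. stable_class g (P_num H)) (gram_set g) (pointed_reps g // stable_rel g) \<and>
      (\<forall>H \<in> gram_set g.
        (LEAST N. \<exists>P \<in> stable_class g (P_num H). dim_vec P = N) = vec_space.rank 9 H))
     \<and>
     (\<forall>H \<in> gram_set g.
        (\<forall>m. \<forall>C \<in> carrier_mat m 9. H = mat_adjoint C * C \<longrightarrow>
            E_space H = cspan (set\<^sub>v (mat_act C V_mono))) \<and>
        (reduced (P_num H) g \<longleftrightarrow>
            \<not> (\<exists>d. nonconstant d \<and> d dvd g \<and> (\<forall>p \<in> E_space H. d dvd p))))
     \<and>
     (\<forall>H \<in> gram_set g. vec_degree (P_num H) = 3 \<longleftrightarrow> cubic_block H \<noteq> 0\<^sub>m 4 4)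
     \<and>
     (\<forall>H \<in> gram_set g.
        (full_rank (P_num H) \<longleftrightarrow> vec_space.rank 9 H = 9) \<and>
        (vec_space.rank 9 H = 9 \<longleftrightarrow> pos_def 9 H) \<and>
        (full_rank (P_num H) \<longrightarrow> reduced (P_num H) g \<and> vec_degree (P_num H) = 3))"
proof -
  have nz: "eval2 g z \<noteq> 0" if "norm z \<le> 1" for z
    using g_poly_nonzero assms that by blast
  have g0: "eval2 g (0, 0) = 1" using assms(5) by (simp add: g_poly_eval)
  have part1: "pointed (P_num H) g \<and> sphere_map (F_map H g) (P_num H) g \<and>
      F_map H g ` ball (0, 0) 1 \<subseteq> unit_ball 9" if H: "H \<in> gram_set g" for H
  proof -
    have rep: "P_num H \<in> pointed_reps g"
      using mat_act_V_in_pointed_reps[OF P_num_factor(1)[OF H] g0] H by (simp add: P_num_factor(2,3)[OF H])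
    then have P: "pointed (P_num H) g" and sph: "sphere_identity (P_num H) g"
      by (auto simp: pointed_reps_def)
    have dim: "dim_vec (P_num H) = 9"
      using P_num_factor(1)[OF H] by (simp add: P_num_factor(3)[OF H])
    have "F_map H g z \<in> unit_ball 9" if "z \<in> ball (0, 0) 1" for z
    proof -
      have "norm z < 1" using that by (simp add: zero_prod_def[symmetric])
      then have "sq_norm2 (F_map H g z) < 1"
        unfolding F_map_def using P by (intro quotient_map_in_unit_ball[OF sph _ nz]) (auto simp: pointed_def)
      moreover have "F_map H g z \<in> carrier_vec 9"
        by (rule carrier_vecI) (simp add: F_map_def quotient_map_def dim)
      ultimately show ?thesis by (simp add: unit_ball_def)
    qed
    then show ?thesis
      using P quotient_sphere_map[OF sph nz] by (auto simp: F_map_def)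
  qed
  have E: "E_space H = cspan (set\<^sub>v (mat_act C V_mono))"
    if "C \<in> carrier_mat m 9" "H = mat_adjoint C * C" for H C m
    using E_space_gram[OF that(1)] that(2) by simp
  have E_P: "E_space H = cspan (set\<^sub>v (P_num H))" if H: "H \<in> gram_set g" for H
    using E[OF P_num_factor(1)[OF H]] by (simp add: P_num_factor(2,3)[OF H])
  have part3: "reduced (P_num H) g \<longleftrightarrow> \<not> (\<exists>d. nonconstant d \<and> d dvd g \<and> (\<forall>p \<in> E_space H. d dvd p))"
    if H: "H \<in> gram_set g" for H
    unfolding E_P[OF H] by (rule reduced_iff_span)
  have part5: "(full_rank (P_num H) \<longleftrightarrow> vec_space.rank 9 H = 9) \<and>
      (vec_space.rank 9 H = 9 \<longleftrightarrow> pos_def 9 H) \<and>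
      (full_rank (P_num H) \<longrightarrow> reduced (P_num H) g \<and> vec_degree (P_num H) = 3)"
    if H: "H \<in> gram_set g" for H
  proof -
    have psd: "psd 9 H" using H by (simp add: gram_set_def)
    then have H': "H \<in> carrier_mat 9 9" by (simp add: psd_def)
    have full: "full_rank (P_num H) \<longleftrightarrow> vec_space.rank 9 H = 9"
      unfolding full_rank_def E_P[OF H, symmetric] by (rule E_space_eq_W_space_iff[OF H'])
    have pos: "vec_space.rank 9 H = 9 \<longleftrightarrow> pos_def 9 H" by (rule psd_full_rank_iff_pos_def[OF psd])
    have "reduced (P_num H) g \<and> vec_degree (P_num H) = 3" if fr: "full_rank (P_num H)"
    proof
      have "E_space H = W_space" using fr by (simp add: full_rank_def E_P[OF H])
      then show "reduced (P_num H) g"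
        unfolding part3[OF H] using common_divisor_of_variables_constant variables_in_W_space by metis
      have "pos_def 9 H" using fr full pos by simp
      then have "cubic_block H $$ (0, 0) \<noteq> 0"
        using pos_def_diagonal_nonzero[of 9 H 5] by (simp add: cubic_block_def)
      then have "cubic_block H \<noteq> 0\<^sub>m 4 4" by auto
      then show "vec_degree (P_num H) = 3" using degree_three_iff_cubic_block[OF H] by simp
    qed
    then show ?thesis using full pos by blast
  qed
  show ?thesis
    by (intro conjI)
      ((rule ballI, rule part1, assumption),
       rule stable_classes_bij[OF g0],
       (rule ballI, rule least_dimension_of_class[OF g0], assumption),
       (rule ballI, rule conjI, intro allI ballI impI, rule E, assumption, assumption, rule part3, assumption),
       (rule ballI, rule degree_three_iff_cubic_block, assumption),
       (rule ballI, rule part5, assumption))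
qed

end
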